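(* For each $n\ge2$ and all $2\le k\le n$ there exists a strictly defined nontrivial $k$-fold Massey product $\langle\alpha^n_1,\dots,\alpha^n_k\rangle$ in $H^*(\mathcal Z_{P^n_{Mas}})$. Furthermore, for each $2\le r\le s$ there exists a natural embedding of simplicial complexes $j_r^s: N_{B(P,r)}\hookrightarrow N_{B(P,s)}$ such that $$(j_r^s)^*\langle\alpha^s_1,\dots,\alpha^s_k\rangle=\langle\alpha^r_1,\dots,\alpha^r_k\rangle\quad\text{for all }2\le k\le r.$$
   Context: A building set on $[n+1]=\{1,\dots,n+1\}$ is a set $B\subseteq2^{[n+1]}$ of nonempty subsets containing all singletons and such that $S_1,S_2\in B$, $S_1\cap S_2\neq\varnothing$ imply $S_1\cup S_2\in B$; it is connected if $[n+1]\in B$. For connected $B$ the nestohedron $P_B$ is the simple $n$-polytope $\sum_{S\in B}\operatorname{conv}(e_i\mid i\in S)\subset\mathbb R^{n+1}$. For a simple polytope $P$ with facets $F_1,\dots,F_m$, the nerve complex $K_P$ on $[m]$ consists of the $I$ with $\bigcap_{i\in I}F_i\ne\varnothing$. The nested set complex $N_B=K_{P_B}$ has vertices the elements of $B\setminus\{[n+1]\}$; a set $\{S_1,\dots,S_k\}$ of vertices is a simplex iff any two $S_p,S_q$ are disjoint or nested, and for any $l\ge2$ pairwise disjoint sets among them the union is not in $B$. For $n\ge2$, $P^n_{Mas}=P_{B(P,n)}$, where $B(P,n)$ is the building set on $[n+1]$ consisting of all singletons, all sets $\{1,2\}\cup I$ with $I\subseteq\{3,\dots,n+1\}$ (including $I=\varnothing$),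 and all sets $\{1\}\cup J$ with $\varnothing\neq J\subseteq\{3,\dots,n\}$. For a simplicial complex $K$ on $[m]$, the moment-angle complex is $\mathcal Z_K=\bigcup_{I\in K}\{z\in(D^2)^m: |z_i|=1\text{ for }i\notin I\}$. For a simple polytope $P$, the moment-angle manifold $\mathcal Z_P$ is canonically homeomorphic to $\mathcal Z_{K_P}$. A simplicial embedding $j:L\hookrightarrow K$ induces an embedding $\mathcal Z_L\to\mathcal Z_K$ (coordinates not in the image are set equal to $1$), and $j^*:H^*(\mathcal Z_K)\to H^*(\mathcal Z_L)$ denotes the induced map. Cohomology is with coefficients in $\mathbf k$, a field of characteristic zero or $\mathbb Z$; $H^*(\mathcal Z_K)$ is the cohomology of the differential graded algebra $R^*(K)=\Lambda[u_1,\dots,u_m]\otimes\mathbf k[K]/(v_i^2=u_iv_i=0)$, $du_i=v_i$, $dv_i=0$, $\deg u_i=1$, $\deg v_i=2$, where $\mathbf k[K]=\mathbf k[v_1,\dots,v_m]/(v_{i_1}\cdots v_{i_p}:\{i_1,\dots,i_p\}\notin K)$. Massey products: let $(A,d)$ be a differential graded algebra and $\alpha_i=[a_i]\in H^{n_i}(A)$, $1\le i\le k$. A defining system is a $(k+1)\times(k+1)$ matrix $C=(c_{i,j})$ over $A$ with $c_{i,j}=0$ for $i\ge j$, $c_{i,i+1}=a_i$, and $a\cdot E_{1,k+1}=dC-\bar C\cdot C$ for some $a=a(C)\in A$, where $\bar c_{i,j}=(-1)^{\deg c_{i,j}}c_{i,j}$ and $E_{1,k+1}$ has a single nonzero entry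 $1$ in position $(1,k+1)$. Then $a(C)$ is a cocycle. $\langle\alpha_1,\dots,\alpha_k\rangle$ is defined if a defining system exists, and it is then the set of all classes $[a(C)]$. It is trivial if it contains $0$ (nontrivial otherwise), and strictly defined if it consists of a single class. The classes $\alpha^n_1,\dots,\alpha^n_k$ in the claim may depend on $k$.
   Formalization: Defining systems are required to be homogeneous for the multigrading of R^*(K), not just the total degree; with total degree only the claim fails (k=3, r=3, s=4: every nonzero class in H^3 for n=4 has nonzero product with H^5, so no such triple product is strictly defined). *)

theory Defs
  imports Main "HOL-Library.Function_Algebras" "HOL-Library.Nat_Bijection"
begin

definition building_set :: "nat \<Rightarrow> nat set set \<Rightarrow> bool" where
  "building_set n B \<longleftrightarrow>
     (\<forall>S\<in>B. S \<noteq> {} \<and> S \<subseteq> {1..n+1}) \<and> (\<forall>i\<in>{1..n+1}. {i} \<in> B) \<and>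
     (\<forall>S\<in>B. \<forall>T\<in>B. S \<inter> T \<noteq> {} \<longrightarrow> S \<union> T \<in> B)"

definition connected_building_set :: "nat \<Rightarrow> nat set set \<Rightarrow> bool" where
  "connected_building_set n B \<longleftrightarrow> building_set n B \<and> {1..n+1} \<in> B"

text \<open>
  For a connected building set \<open>B\<close> on \<open>{1..n+1}\<close> the facets of the nestohedron of \<open>B\<close> are indexed
  by the vertices below, and the nested set complex is its nerve complex.
\<close>

definition nested_vertices :: "nat \<Rightarrow> nat set set \<Rightarrow> nat set set" where
  "nested_vertices n B = B - {{1..n+1}}"

definition nested_complex :: "nat \<Rightarrow> nat set set \<Rightarrow> nat set set set" where
  "nested_complex n B =
     {\<sigma>. \<sigma> \<subseteq> nested_vertices n B \<and>
          (\<forall>S\<in>\<sigma>. \<forall>T\<in>\<sigma>. S \<inter> T = {} \<or> S \<subseteq> T \<or> T \<subseteq> S) \<and>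
          (\<forall>\<tau>\<subseteq>\<sigma>. card \<tau> \<ge> 2 \<longrightarrow> pairwise disjnt \<tau> \<longrightarrow> \<Union>\<tau> \<notin> B)}"

definition mas_building_set :: "nat \<Rightarrow> nat set set" where
  "mas_building_set n =
     {{i} | i. i \<in> {1..n+1}} \<union> {{1,2} \<union> I | I. I \<subseteq> {3..n+1}} \<union> {{1} \<union> J | J. J \<noteq> {} \<and> J \<subseteq> {3..n}}"

lemma mas_building_set_iff:
  "S \<in> mas_building_set n \<longleftrightarrow>
     (\<exists>i\<in>{1..n+1}. S = {i}) \<or>
     (1 \<in> S \<and> 2 \<in> S \<and> S \<subseteq> {1,2} \<union> {3..n+1}) \<or>
     (1 \<in> S \<and> 2 \<notin> S \<and> S \<noteq> {1} \<and> S \<subseteq> {1} \<union> {3..n})"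
proof
  assume "S \<in> mas_building_set n"
  then show "(\<exists>i\<in>{1..n+1}. S = {i}) \<or> (1 \<in> S \<and> 2 \<in> S \<and> S \<subseteq> {1,2} \<union> {3..n+1}) \<or>
     (1 \<in> S \<and> 2 \<notin> S \<and> S \<noteq> {1} \<and> S \<subseteq> {1} \<union> {3..n})"
    unfolding mas_building_set_def by auto
next
  assume *: "(\<exists>i\<in>{1..n+1}. S = {i}) \<or> (1 \<in> S \<and> 2 \<in> S \<and> S \<subseteq> {1,2} \<union> {3..n+1}) \<or>
     (1 \<in> S \<and> 2 \<notin> S \<and> S \<noteq> {1} \<and> S \<subseteq> {1} \<union> {3..n})"
  then consider i where "i \<in> {1..n+1}" "S = {i}"
    | "1 \<in> S" "2 \<in> S" "S \<subseteq> {1,2} \<union> {3..n+1}"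
    | "1 \<in> S" "S \<noteq> {1}" "S \<subseteq> {1} \<union> {3..n}" by metis
  then show "S \<in> mas_building_set n"
  proof cases
    case 1
    then show ?thesis unfolding mas_building_set_def by auto
  next
    case 2
    then have "S = {1,2} \<union> (S - {1,2})" "S - {1,2} \<subseteq> {3..n+1}" by auto
    then have "S \<in> {{1,2} \<union> I | I. I \<subseteq> {3..n+1}}" by (intro CollectI exI conjI)
    then show ?thesis unfolding mas_building_set_def by (rule UnI2[THEN UnI1])
  next
    case 3
    then have "S = {1} \<union> (S - {1})" "S - {1} \<noteq> {}" "S - {1} \<subseteq> {3..n}" by auto
    then have "S \<in> {{1} \<union> J | J. J \<noteq> {} \<and> J \<subseteq> {3..n}}" by (intro CollectI exI conjI)
    then show ?thesis unfolding mas_building_set_def by (rule UnI2)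
  qed
qed

lemma connected_building_set_mas:
  assumes "n \<ge> 2"
  shows "connected_building_set n (mas_building_set n)"
proof -
  have "S \<union> T \<in> mas_building_set n"
    if S: "S \<in> mas_building_set n" and T: "T \<in> mas_building_set n" and ST: "S \<inter> T \<noteq> {}" for S T
  proof (cases "(\<exists>i. S = {i}) \<or> (\<exists>i. T = {i})")
    case True
    then have "S \<union> T = S \<or> S \<union> T = T" using ST by auto
    then show ?thesis using S T by metis
  next
    case False
    define A where "A = {3..n+1}"
    define A' where "A' = {3..n}"
    have "A' \<subseteq> A" unfolding A_def A'_def by auto
    have *: "1 \<in> X \<and> X \<noteq> {1} \<and> X \<subseteq> {1,2} \<union> A \<and> (2 \<notin> X \<longrightarrow> X \<subseteq> {1} \<union> A')"
      if "X \<in> mas_building_set n" "\<nexists>i. X = {i}" for X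
    proof -
      have "(1 \<in> X \<and> 2 \<in> X \<and> X \<subseteq> {1,2} \<union> A) \<or> (1 \<in> X \<and> 2 \<notin> X \<and> X \<subseteq> {1} \<union> A')"
        using that unfolding mas_building_set_iff A_def A'_def by metis
      moreover have "X \<noteq> {1}" using that(2) by metis
      ultimately show ?thesis using \<open>A' \<subseteq> A\<close> by fast
    qed
    have S': "1 \<in> S" "S \<noteq> {1}" "S \<subseteq> {1,2} \<union> A" "2 \<notin> S \<longrightarrow> S \<subseteq> {1} \<union> A'"
      using *[of S] S False by simp_all
    have T': "1 \<in> T" "T \<noteq> {1}" "T \<subseteq> {1,2} \<union> A" "2 \<notin> T \<longrightarrow> T \<subseteq> {1} \<union> A'"
      using *[of T] T False by simp_all
    have "1 \<in> S \<union> T" "S \<union> T \<noteq> {1}" "S \<union> T \<subseteq> {1,2} \<union> A"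
      using S'(1-3) T'(1,3) by auto
    moreover have "2 \<notin> S \<union> T \<longrightarrow> S \<union> T \<subseteq> {1} \<union> A'" using S'(4) T'(4) by simp
    ultimately have "(1 \<in> S \<union> T \<and> 2 \<in> S \<union> T \<and> S \<union> T \<subseteq> {1,2} \<union> A) \<or>
        (1 \<in> S \<union> T \<and> 2 \<notin> S \<union> T \<and> S \<union> T \<noteq> {1} \<and> S \<union> T \<subseteq> {1} \<union> A')"
      by metis
    then show ?thesis unfolding mas_building_set_iff A_def A'_def by metis
  qed
  moreover have "{1..n+1} \<in> mas_building_set n"
    unfolding mas_building_set_iff using assms by auto
  moreover have "\<forall>S\<in>mas_building_set n. S \<noteq> {} \<and> S \<subseteq> {1..n+1}"
    unfolding mas_building_set_def using assms by auto
  moreover have "\<forall>i\<in>{1..n+1}. {i} \<in> mas_building_set n"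
    unfolding mas_building_set_def by auto
  ultimately show ?thesis
    unfolding connected_building_set_def building_set_def by blast
qed

abbreviation N_mas :: "nat \<Rightarrow> nat set set set" where
  "N_mas n \<equiv> nested_complex n (mas_building_set n)"

definition simplicial_embedding :: "('v \<Rightarrow> 'w) \<Rightarrow> 'v set set \<Rightarrow> 'w set set \<Rightarrow> bool" where
  "simplicial_embedding j L K \<longleftrightarrow> inj_on j (\<Union>L) \<and> (\<forall>\<sigma>\<in>L. j ` \<sigma> \<in> K)"


text \<open>
  A differential graded algebra which, besides its degree \<open>n\<close>, carries an internal grading by
  weights \<open>w\<close> in a commutative monoid: the product adds degrees and weights, the differential
  raises the degree by one and preserves the weight; \<open>comp A n w\<close> is the component of degree \<open>n\<close>
  and weight \<open>w\<close>.  An algebra without internal grading is the case of the one-element monoid.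
\<close>

record ('w, 'a) dga =
  carrier :: "'a set"
  comp :: "int \<Rightarrow> 'w \<Rightarrow> 'a set"
  mult :: "'a \<Rightarrow> 'a \<Rightarrow> 'a"
  diff :: "'a \<Rightarrow> 'a"

definition cohom_class :: "('w, 'a::ab_group_add) dga \<Rightarrow> 'a \<Rightarrow> 'a set" where
  "cohom_class A a = {a + diff A y | y. y \<in> carrier A}"

definition cohomology :: "('w, 'a::ab_group_add) dga \<Rightarrow> int \<Rightarrow> 'w \<Rightarrow> 'a set set" where
  "cohomology A n w = {cohom_class A a | a. a \<in> comp A n w \<and> diff A a = 0}"

text \<open>
  Let \<open>\<alpha> i\<close> have degree \<open>N i\<close> and weight \<open>W i\<close> for \<open>1 \<le> i \<le> k\<close>.  The entry in position
  \<open>(i,j)\<close>, \<open>i < j\<close>, of a defining system is homogeneous of the degree and weight forced by its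
  Maurer-Cartan equation.  The differential preserves weights, so only the degree is shifted.
  Homogeneity with respect to the weights matters: if the entries were only required to be
  homogeneous for the degree, one could add cocycles of unrelated weights to them, which in general
  enlarges the set of classes obtained.  The first superdiagonal may be filled with any homogeneous
  representatives of the given classes.
\<close>

definition entry_degree :: "(nat \<Rightarrow> int) \<Rightarrow> nat \<Rightarrow> nat \<Rightarrow> int" where
  "entry_degree N i j = (\<Sum>l\<in>{i..<j}. N l) - (int j - int i - 1)"

definition entry_bar :: "(nat \<Rightarrow> int) \<Rightarrow> (nat \<Rightarrow> nat \<Rightarrow> 'a::ab_group_add) \<Rightarrow> nat \<Rightarrow> nat \<Rightarrow> 'a" where
  "entry_bar N c i j = (if even (entry_degree N i j) then c i j else - c i j)"

definition defining_system ::
  "('w::comm_monoid_add, 'a::ab_group_add) dga \<Rightarrow> nat \<Rightarrow> (nat \<Rightarrow> int) \<Rightarrow> (nat \<Rightarrow> 'w) \<Rightarrow>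
    (nat \<Rightarrow> 'a set) \<Rightarrow> (nat \<Rightarrow> nat \<Rightarrow> 'a) \<Rightarrow> 'a \<Rightarrow> bool"
where
  "defining_system A k N W \<alpha> c a \<longleftrightarrow>
     (\<forall>i\<in>{1..k+1}. \<forall>j\<in>{1..k+1}. i \<ge> j \<longrightarrow> c i j = 0) \<and>
     (\<forall>i\<in>{1..k+1}. \<forall>j\<in>{1..k+1}. i < j \<longrightarrow>
        c i j \<in> comp A (entry_degree N i j) (\<Sum>l\<in>{i..<j}. W l)) \<and>
     (\<forall>i\<in>{1..k}. c i (i+1) \<in> \<alpha> i) \<and>
     a \<in> carrier A \<and>
     (\<forall>i\<in>{1..k+1}. \<forall>j\<in>{1..k+1}.
        (if i = 1 \<and> j = k+1 then a else 0) =
        diff A (c i j) - (\<Sum>l\<in>{1..k+1}. mult A (entry_bar N c i l) (c l j)))"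

definition massey_product ::
  "('w::comm_monoid_add, 'a::ab_group_add) dga \<Rightarrow> nat \<Rightarrow> (nat \<Rightarrow> int) \<Rightarrow> (nat \<Rightarrow> 'w) \<Rightarrow>
    (nat \<Rightarrow> 'a set) \<Rightarrow> 'a set set"
where
  "massey_product A k N W \<alpha> = {cohom_class A a | a c. defining_system A k N W \<alpha> c a}"

definition massey_strictly_defined where
  "massey_strictly_defined A k N W \<alpha> \<longleftrightarrow> (\<exists>\<omega>. massey_product A k N W \<alpha> = {\<omega>})"

definition massey_nontrivial where
  "massey_nontrivial A k N W \<alpha> \<longleftrightarrow>
     massey_product A k N W \<alpha> \<noteq> {} \<and> cohom_class A 0 \<notin> massey_product A k N W \<alpha>"


text \<open>
  The algebra \<open>R\<^sup>*(K)\<close>, for a finite simplicial complex \<open>K\<close> all of whose vertices \<open>v\<close> satisfy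
  \<open>{v} \<in> K\<close>.  The relations defining it as a quotient of the exterior algebra on the \<open>u\<^sub>i\<close>
  tensored with the polynomial algebra on the \<open>v\<^sub>i\<close> equate monomials to zero, up to the
  exterior relations, so \<open>R\<^sup>*(K)\<close> is the free module on the surviving monomials
  \<open>u\<^sub>J v\<^sub>I\<close> with \<open>I \<in> K\<close> and \<open>J\<close> disjoint from \<open>I\<close>.  An element is the function giving its
  coefficients at \<open>(J, I)\<close>.  The injective numbering \<open>e\<close> of the vertices orders the factors of
  \<open>u\<^sub>J\<close> increasingly; \<open>shuffle_sign e J J'\<close> is the sign in \<open>u\<^sub>J u\<^sub>J' = \<plusminus> u\<^bsub>J \<union> J'\<^esub>\<close>.
\<close>

definition R_basis :: "'v set set \<Rightarrow> ('v set \<times> 'v set) set" where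
  "R_basis K = {(J, I). J \<subseteq> \<Union>K \<and> I \<in> K \<and> J \<inter> I = {}}"

definition shuffle_sign :: "('v \<Rightarrow> nat) \<Rightarrow> 'v set \<Rightarrow> 'v set \<Rightarrow> 'k::comm_ring_1" where
  "shuffle_sign e J J' = (-1) ^ card {(p, q). p \<in> J \<and> q \<in> J' \<and> e q < e p}"

definition R_carrier :: "'v set set \<Rightarrow> ('v set \<times> 'v set \<Rightarrow> 'k::comm_ring_1) set" where
  "R_carrier K = {x. \<forall>b. b \<notin> R_basis K \<longrightarrow> x b = 0}"

text \<open>
  The multigrading: \<open>u\<^sub>i\<close> and \<open>v\<^sub>i\<close> have degrees 1 and 2, and both have the \<open>i\<close>-th unit vector as
  weight.
\<close>

definition R_comp ::
  "'v set set \<Rightarrow> int \<Rightarrow> ('v \<Rightarrow> nat) \<Rightarrow> ('v set \<times> 'v set \<Rightarrow> 'k::comm_ring_1) set" where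
  "R_comp K n w =
     {x \<in> R_carrier K. \<forall>J I. x (J, I) \<noteq> 0 \<longrightarrow>
        int (card J + 2 * card I) = n \<and> w = (\<lambda>i. if i \<in> J \<union> I then 1 else 0)}"

definition R_mult ::
  "('v \<Rightarrow> nat) \<Rightarrow> 'v set set \<Rightarrow> ('v set \<times> 'v set \<Rightarrow> 'k::comm_ring_1) \<Rightarrow>
    ('v set \<times> 'v set \<Rightarrow> 'k) \<Rightarrow> 'v set \<times> 'v set \<Rightarrow> 'k"
where
  "R_mult e K x y = (\<lambda>(J, I). if (J, I) \<in> R_basis K
     then \<Sum>J1\<in>Pow J. \<Sum>I1\<in>Pow I.
            shuffle_sign e J1 (J - J1) * x (J1, I1) * y (J - J1, I - I1)
     else 0)"

text \<open>
  By the Leibniz rule \<open>d u\<^sub>J\<close> is the sum over \<open>i \<in> J\<close> of \<open>\<plusminus> u\<^bsub>J - {i}\<^esub> v\<^sub>i\<close>, the sign being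
  \<open>-1\<close> to the number of elements of \<open>J\<close> before \<open>i\<close>.
\<close>

definition R_diff ::
  "('v \<Rightarrow> nat) \<Rightarrow> 'v set set \<Rightarrow> ('v set \<times> 'v set \<Rightarrow> 'k::comm_ring_1) \<Rightarrow> 'v set \<times> 'v set \<Rightarrow> 'k"
where
  "R_diff e K x = (\<lambda>(J, I). if (J, I) \<in> R_basis K
     then \<Sum>i\<in>I. (-1) ^ card {p \<in> J. e p < e i} * x (insert i J, I - {i})
     else 0)"

text \<open>The monomials \<open>u\<^sub>J v\<^sub>I\<close> multiply by the rules of the presentation.\<close>

definition R_mono :: "'v set set \<Rightarrow> 'v set \<Rightarrow> 'v set \<Rightarrow> 'v set \<times> 'v set \<Rightarrow> 'k::comm_ring_1" where
  "R_mono K J I = (\<lambda>b. if b = (J, I) \<and> b \<in> R_basis K then 1 else 0)"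

lemma R_mult_mono:
  assumes "finite (\<Union>K)" "\<And>\<sigma> \<tau>. \<sigma> \<in> K \<Longrightarrow> \<tau> \<subseteq> \<sigma> \<Longrightarrow> \<tau> \<in> K"
  shows "R_mult e K (R_mono K J I) (R_mono K J' I') =
    (\<lambda>b. if J \<inter> J' = {} \<and> I \<inter> I' = {} then shuffle_sign e J J' * R_mono K (J \<union> J') (I \<union> I') b else 0)"
    (is "?L = ?R")
proof
  fix b :: "'a set \<times> 'a set"
  obtain P Q where b: "b = (P, Q)" by (cases b)
  show "?L b = ?R b"
  proof (cases "b \<in> R_basis K")
    case False
    then show ?thesis by (simp add: b R_mult_def R_mono_def)
  next
    case True
    then have PK: "P \<subseteq> \<Union>K" and QK: "Q \<in> K" and PQ: "P \<inter> Q = {}"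
      by (auto simp: b R_basis_def)
    then have fin: "finite P" "finite Q"
      using assms(1) by (meson finite_subset Union_upper)+
    have sub: "(P1, Q1) \<in> R_basis K" if "P1 \<subseteq> P" "Q1 \<subseteq> Q" for P1 Q1
      using that PK QK PQ assms(2) unfolding R_basis_def by blast
    have delta: "(\<Sum>X\<in>F. if X = Y \<and> C then s else 0) = (if Y \<in> F \<and> C then s else 0)"
      if "finite F" for F :: "'a set set" and Y C and s :: 'b
      using that by (cases C) simp_all
    have "?L b = (\<Sum>J1\<in>Pow P. \<Sum>I1\<in>Pow Q.
        if I1 = I \<and> (J1 = J \<and> P - J = J' \<and> Q - I = I') then shuffle_sign e J J' else 0)"
      using True by (auto simp: b R_mult_def R_mono_def sub intro!: sum.cong)
    also have "\<dots> = (\<Sum>J1\<in>Pow P.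
        if J1 = J \<and> (I \<in> Pow Q \<and> P - J = J' \<and> Q - I = I') then shuffle_sign e J J' else 0)"
      by (intro sum.cong refl, subst delta) (use fin in auto)
    also have "\<dots> = (if J \<subseteq> P \<and> I \<subseteq> Q \<and> P - J = J' \<and> Q - I = I' then shuffle_sign e J J' else 0)"
      by (subst delta) (use fin in auto)
    also have "\<dots> = (if J \<inter> J' = {} \<and> I \<inter> I' = {} \<and> P = J \<union> J' \<and> Q = I \<union> I'
        then shuffle_sign e J J' else 0)"
    proof -
      have "(J \<subseteq> P \<and> I \<subseteq> Q \<and> P - J = J' \<and> Q - I = I') \<longleftrightarrow>
          (J \<inter> J' = {} \<and> I \<inter> I' = {} \<and> P = J \<union> J' \<and> Q = I \<union> I')" by blast
      then show ?thesis by simp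
    qed
    also have "\<dots> = ?R b"
      using True by (simp add: b R_mono_def)
    finally show ?thesis .
  qed
qed

lemma R_diff_u:
  assumes "{i} \<in> K" "{} \<in> K"
  shows "R_diff e K (R_mono K {i} {}) = R_mono K {} {i}"
proof
  fix b :: "'a set \<times> 'a set"
  obtain P Q where b: "b = (P, Q)" by (cases b)
  have "(\<Sum>l\<in>Q. (-1) ^ card {p \<in> P. e p < e l} * R_mono K {i} {} (insert l P, Q - {l})) =
      (if P = {} \<and> Q = {i} then 1 else (0::'b))" if "(P, Q) \<in> R_basis K"
  proof (cases "P = {} \<and> Q = {i}")
    case True
    then show ?thesis using assms by (auto simp: R_mono_def R_basis_def)
  next
    case False
    have "R_mono K {i} {} (insert l P, Q - {l}) = (0::'b)" if "l \<in> Q" for l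
      using False that \<open>(P, Q) \<in> R_basis K\<close> by (auto simp: R_mono_def R_basis_def)
    then show ?thesis using False by simp
  qed
  then show "R_diff e K (R_mono K {i} {}) b = (R_mono K {} {i} b :: 'b)"
    by (auto simp: b R_diff_def R_mono_def)
qed

definition R_algebra ::
  "('v \<Rightarrow> nat) \<Rightarrow> 'v set set \<Rightarrow> ('v \<Rightarrow> nat, 'v set \<times> 'v set \<Rightarrow> 'k::comm_ring_1) dga" where
  "R_algebra e K =
     \<lparr>carrier = R_carrier K, comp = R_comp K, mult = R_mult e K, diff = R_diff e K\<rparr>"

text \<open>
  For a simplicial embedding \<open>j\<close> of \<open>L\<close> into \<open>K\<close>, the inclusion of moment-angle complexes which sets
  the coordinates outside the image of \<open>j\<close> to 1 induces the algebra homomorphism from \<open>R\<^sup>*(K)\<close> to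
  \<open>R\<^sup>*(L)\<close> with \<open>u\<^bsub>j i\<^esub> \<mapsto> u\<^sub>i\<close> and \<open>v\<^bsub>j i\<^esub> \<mapsto> v\<^sub>i\<close> that sends the remaining generators to 0.  So
  \<open>u\<^bsub>j ` J\<^esub>\<close> goes to \<open>u\<^sub>J\<close> times the sign of the permutation by which \<open>j\<close> reorders \<open>J\<close>.
\<close>

definition R_pullback ::
  "('v \<Rightarrow> nat) \<Rightarrow> ('w \<Rightarrow> nat) \<Rightarrow> 'v set set \<Rightarrow> ('v \<Rightarrow> 'w) \<Rightarrow>
    ('w set \<times> 'w set \<Rightarrow> 'k::comm_ring_1) \<Rightarrow> 'v set \<times> 'v set \<Rightarrow> 'k"
where
  "R_pullback e e' L j x = (\<lambda>(J, I). if (J, I) \<in> R_basis L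
     then (-1) ^ card {(p, q). p \<in> J \<and> q \<in> J \<and> e p < e q \<and> e' (j q) < e' (j p)} * x (j ` J, j ` I)
     else 0)"

definition cohom_pullback ::
  "('v \<Rightarrow> nat) \<Rightarrow> ('w \<Rightarrow> nat) \<Rightarrow> 'v set set \<Rightarrow> ('v \<Rightarrow> 'w) \<Rightarrow>
    ('w set \<times> 'w set \<Rightarrow> 'k::comm_ring_1) set \<Rightarrow> ('v set \<times> 'v set \<Rightarrow> 'k) set"
where
  "cohom_pullback e e' L j \<xi> = (\<Union>x\<in>\<xi>. cohom_class (R_algebra e L) (R_pullback e e' L j x))"

text \<open>
  Vertices of nested set complexes are finite sets of natural numbers; they are numbered by their
  binary codes.
\<close>

abbreviation R_mas :: "nat \<Rightarrow> (nat set \<Rightarrow> nat, nat set set \<times> nat set set \<Rightarrow> 'k::comm_ring_1) dga" where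
  "R_mas n \<equiv> R_algebra set_encode (N_mas n)"

end

theory Submission
  imports Defs
begin

text \<open>
  The vertices \<open>{1..i}\<close> and \<open>{i + 1}\<close>, \<open>1 \<le> i \<le> k\<close>, of \<open>N_mas k\<close> form \<open>k\<close> non-adjacent pairs, and
  the \<open>i\<close>-th class is the generator of the reduced degree 0 cohomology of the \<open>i\<close>-th pair.  By
  multigrading, the entry \<open>(i, j)\<close> of a defining system is a 0-cochain on the full subcomplex spanned
  by the pairs \<open>i, \<dots>, j - 1\<close>, and the Massey product is represented by 1-cochains.  Listed in the
  order of their binary codes, the vertices of each pair precede those of the next one, so the
  shuffle signs are trivial, and the sign in the differential depends only on the position in the
  pair.  The pairs are chosen such that a vertex \<open>{1..p}\<close> is adjacent to no \<open>{q + 1}\<close> with \<open>q \<ge> p\<close>,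
  except for \<open>p = 1\<close> and \<open>q = k\<close>.  Hence the entries can be taken to be indicator functions, all
  obstructions vanish except on that exceptional edge, and the Massey product contains the indicator
  of this edge, which is nonzero on a cycle of length four.  For an arbitrary defining system, the
  Maurer-Cartan equation determines the jump of the last entry along the exceptional edge, so the
  product is a single class.  For \<open>k < n\<close> one takes the image of these pairs under the embedding of
  \<open>N_mas k\<close> into \<open>N_mas n\<close>; the embeddings preserve the order of binary codes, hence commute with
  everything without signs.
\<close>

section \<open>Flat systems of functions\<close>

text \<open>On the edge from \<open>s\<close> to \<open>t\<close> this is the product part of the
  Maurer-Cartan equation for the entry \<open>(i, j)\<close>. Vertex \<open>t\<close> lies in pair
  \<open>t div 2\<close>, so \<open>l\<close> runs over the cuts that leave \<open>s\<close> to the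
  left and \<open>t\<close> to the right.\<close>

definition transport :: "(nat \<Rightarrow> nat \<Rightarrow> nat \<Rightarrow> 'a::comm_ring_1) \<Rightarrow> nat \<Rightarrow> nat \<Rightarrow> nat \<Rightarrow> nat \<Rightarrow> 'a" where
  "transport f i j s t = (\<Sum>l\<in>{s div 2<..t div 2}. f i l s * f l j t)"

text \<open>Flatness moves the left factor from \<open>s\<close> to \<open>t\<close> for cuts beyond
  \<open>t\<close>, and the right factor from \<open>t\<close> to \<open>w\<close> for cuts before
  \<open>t\<close>. Both corrections are the same double sum of triple products, so they
  cancel.\<close>

lemma transport_cocycle:
  assumes "s div 2 \<le> t div 2" "t div 2 \<le> w div 2"
    and left: "\<And>l. l \<in> {t div 2<..w div 2} \<Longrightarrow> f i l t - f i l s + transport f i l s t = 0"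
    and right: "\<And>l. l \<in> {s div 2<..t div 2} \<Longrightarrow> f l j w - f l j t + transport f l j t w = 0"
  shows "transport f i j s t + transport f i j t w = transport f i j s w"
proof -
  have split: "{s div 2<..w div 2} = {s div 2<..t div 2} \<union> {t div 2<..w div 2}"
    using assms(1,2) by auto
  have L: "f i l s = f i l t + transport f i l s t" if "l \<in> {t div 2<..w div 2}" for l
    using left[OF that] by (simp add: algebra_simps)
  have R: "f l j t = f l j w + transport f l j t w" if "l \<in> {s div 2<..t div 2}" for l
    using right[OF that] by (simp add: algebra_simps)
  have "transport f i j s w =
      (\<Sum>l\<in>{s div 2<..t div 2}. f i l s * f l j w) + (\<Sum>l\<in>{t div 2<..w div 2}. f i l s * f l j w)"
    unfolding transport_def split by (rule sum.union_disjoint) auto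
  moreover have "(\<Sum>l\<in>{t div 2<..w div 2}. f i l s * f l j w) =
      transport f i j t w + (\<Sum>l\<in>{t div 2<..w div 2}. transport f i l s t * f l j w)"
    by (simp add: L transport_def[of f i j t w] distrib_right sum.distrib)
  moreover have "transport f i j s t = (\<Sum>l\<in>{s div 2<..t div 2}. f i l s * f l j w) +
      (\<Sum>l\<in>{s div 2<..t div 2}. f i l s * transport f l j t w)"
    by (simp add: R transport_def[of f i j s t] distrib_left sum.distrib)
  moreover have "(\<Sum>l\<in>{t div 2<..w div 2}. transport f i l s t * f l j w) =
      (\<Sum>l\<in>{s div 2<..t div 2}. f i l s * transport f l j t w)"
    unfolding transport_def sum_distrib_left sum_distrib_right
    by (subst sum.swap) (simp add: mult.assoc)
  ultimately show ?thesis by (simp add: algebra_simps)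
qed

lemma sum_triangle_swap:
  fixes g :: "nat \<Rightarrow> nat \<Rightarrow> 'a::comm_monoid_add"
  shows "(\<Sum>l\<in>{a..<b}. \<Sum>m\<in>{a..<l}. g m l) = (\<Sum>m\<in>{a..<b}. \<Sum>l\<in>{m<..<b}. g m l)"
  unfolding sum.Sigma[OF finite_atLeastLessThan ballI[OF finite_atLeastLessThan]]
    sum.Sigma[OF finite_atLeastLessThan ballI[OF finite_greaterThanLessThan]]
  by (rule sum.reindex_bij_witness[of _ prod.swap prod.swap]) auto

text \<open>\<open>h\<close> integrates the transport along edges to \<open>2 * k\<close>.  Its jump is minus the product of a row \<open>D\<close> and
  a column \<open>E\<close>; with \<open>1\<close> the all-one row and \<open>B\<close> strictly upper triangular, flatness gives
  \<open>D = 1 (1 + B)\<close>, and \<open>(1 + B) E\<close> is the last unit column.\<close>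

lemma holonomy:
  fixes f :: "nat \<Rightarrow> nat \<Rightarrow> nat \<Rightarrow> 'a::comm_ring_1"
  assumes k: "2 \<le> k"
    and flat: "\<And>i j s t. \<lbrakk>1 \<le> i; i < j; j \<le> k + 1; (i, j) \<noteq> (1, k + 1); 2 * i \<le> s; s < t; t < 2 * j;
        odd s \<or> even t\<rbrakk> \<Longrightarrow> f i j t - f i j s + transport f i j s t = 0"
    and unit: "\<And>i. \<lbrakk>1 \<le> i; i \<le> k\<rbrakk> \<Longrightarrow> f i (i + 1) (2 * i) = f i (i + 1) (2 * i + 1) + 1"
  shows "\<exists>h. (\<forall>s t. 2 \<le> s \<longrightarrow> s < t \<longrightarrow> t \<le> 2 * k + 1 \<longrightarrow> odd s \<or> even t \<longrightarrow>
             h t - h s + transport f 1 (k + 1) s t = 0) \<and>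
           h (2 * k + 1) - h 2 + transport f 1 (k + 1) 2 (2 * k + 1) = - 1"
proof -
  have step: "f i j s = f i j t + transport f i j s t"
    if "1 \<le> i" "i < j" "j \<le> k + 1" "(i, j) \<noteq> (1, k + 1)" "2 * i \<le> s" "s < t" "t < 2 * j"
      "odd s \<or> even t" for i j s t
    using flat[OF that] by (simp add: algebra_simps)
  define b where "b = transport f 1 (k + 1)"
  \<comment> \<open>Every vertex below \<open>2 * k\<close> has an edge to \<open>2 * k\<close>,
    where \<open>h\<close> is normalized to 0. The remaining vertex \<open>2 * k + 1\<close> is not
    joined to \<open>2 * k\<close>; its value is forced by the edge from 3.\<close>
  define h where "h t = (if t \<le> 2 * k then b t (2 * k) else b 3 (2 * k) - b 3 (2 * k + 1))" for t
  \<comment> \<open>All cuts satisfy \<open>1 < l\<close> and \<open>l <= k\<close>, so flatness is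
    used only for the entries \<open>(1, l)\<close> and \<open>(l, k + 1)\<close>, never for the
    excluded \<open>(1, k + 1)\<close>.\<close>
  have coc: "b s t + b t w = b s w"
    if "2 \<le> s" "s < t" "t < w" "w \<le> 2 * k + 1" "odd s \<or> even t" "odd t \<or> even w" for s t w
  proof -
    have div: "s div 2 < t div 2" "t div 2 < w div 2" using that by presburger+
    have "t < 2 * l \<and> 1 < l \<and> l \<le> k" if "l \<in> {t div 2<..w div 2}" for l
      using that div \<open>w \<le> 2 * k + 1\<close> \<open>2 \<le> s\<close> by auto
    moreover have "2 * l \<le> t \<and> 1 < l \<and> l \<le> k" if "l \<in> {s div 2<..t div 2}" for l
      using that div \<open>w \<le> 2 * k + 1\<close> \<open>2 \<le> s\<close> by auto
    ultimately show ?thesis unfolding b_def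
      by (intro transport_cocycle flat) (use that div in auto)
  qed
  have "h t - h s + b s t = 0" if "2 \<le> s" "s < t" "t \<le> 2 * k + 1" "odd s \<or> even t" for s t
  proof -
    consider "t < 2 * k" | "t = 2 * k" | "t = 2 * k + 1" using \<open>t \<le> 2 * k + 1\<close> by linarith
    then show ?thesis
    proof cases
      case 1
      then have "b s (2 * k) = b s t + b t (2 * k)" using coc[of s t "2 * k"] that by simp
      then show ?thesis using 1 that by (simp add: h_def)
    next
      case 2
      then show ?thesis using that by (simp add: h_def b_def transport_def)
    next
      case 3
      then have "odd s" using that(4) by simp
      show ?thesis
      proof (cases "s = 3")
        case True
        then show ?thesis using 3 that k by (simp add: h_def)
      next
        case False
        then have "3 < s" "s < 2 * k" using \<open>odd s\<close> that 3 by presburger+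
        \<comment> \<open>Both \<open>2 * k\<close> and \<open>2 * k + 1\<close> are reached from 3
          through \<open>s\<close>, so the share of the edge from 3 to \<open>s\<close> cancels in
          \<open>h t - h s\<close>.\<close>
        then have "b 3 (2 * k) = b 3 s + b s (2 * k)" "b 3 t = b 3 s + b s t"
          using coc[of 3 s "2 * k"] coc[of 3 s t] \<open>odd s\<close> 3 by simp_all
        then show ?thesis using 3 \<open>s < 2 * k\<close> by (simp add: h_def)
      qed
    qed
  qed
  moreover have "h (2 * k + 1) - h 2 + b 2 (2 * k + 1) = - 1"
  proof -
    \<comment> \<open>\<open>D\<close> is the jump of the first row across the first pair,
      \<open>E\<close> that of the last column across the last pair. The four transports from 2 or 3
      to \<open>2 * k\<close> or \<open>2 * k + 1\<close> have the same cuts, so their alternating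
      sum factors as the product of \<open>D\<close> and \<open>E\<close>.\<close>
    define D where "D l = f 1 l 2 - f 1 l 3" for l
    define E where "E l = f l (k + 1) (2 * k) - f l (k + 1) (2 * k + 1)" for l
    \<comment> \<open>\<open>A\<close> evaluates an entry at the even vertex of its last pair,
      \<open>B\<close> at the odd vertex of its first pair. These two vertices span an edge unless
      the entry covers a single pair.\<close>
    define A where "A m l = f m l (2 * l - 2)" for m l
    define B where "B m l = f m l (2 * m + 1)" for m l
    \<comment> \<open>In matrix form, \<open>(1 + B) A\<close> is \<open>B\<close> plus the
      superdiagonal unit matrix: the unit jump accounts for single pairs, flatness for all longer
      entries.\<close>
    have AB: "A m l + (\<Sum>q\<in>{m<..<l}. B m q * A q l) = B m l + (if l = m + 1 then 1 else 0)"
      if "2 \<le> m" "m < l" "l \<le> k" for m l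
    proof (cases "l = m + 1")
      case True
      have "{m<..<l} = {}" using True by auto
      then show ?thesis using unit[of m] that True by (simp add: A_def B_def)
    next
      case False
      have eq: "{m<..(2 * l - 2) div 2} = {m<..<l}" using that by auto
      have "f m l (2 * m + 1) = f m l (2 * l - 2) + transport f m l (2 * m + 1) (2 * l - 2)"
        by (rule step) (use that False in auto)
      then show ?thesis using False eq
        by (simp add: A_def B_def transport_def algebra_simps)
    qed
    \<comment> \<open>Both 2 and 3 have an edge to \<open>2 * l - 2\<close>; subtracting the two
      flatness equations eliminates the common value there.\<close>
    have Drec: "D l = (\<Sum>m\<in>{2..<l}. D m * A m l)" if "3 \<le> l" "l \<le> k" for l
    proof -
      have eq: "{Suc 0<..(2 * l - 2) div 2} = {2..<l}" using that by auto
      have "f 1 l 2 = f 1 l (2 * l - 2) + transport f 1 l 2 (2 * l - 2)"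
        "f 1 l 3 = f 1 l (2 * l - 2) + transport f 1 l 3 (2 * l - 2)"
        by (rule step; use that in auto)+
      then have "D l = transport f 1 l 2 (2 * l - 2) - transport f 1 l 3 (2 * l - 2)"
        by (simp add: D_def)
      then show ?thesis using eq
        by (simp add: transport_def D_def A_def left_diff_distrib sum_subtractf)
    qed
    have D: "D l = 1 + (\<Sum>m\<in>{2..<l}. B m l)" if "2 \<le> l" "l \<le> k" for l
      using that
    proof (induction l rule: less_induct)
      case (less l)
      show ?case
      proof (cases "l = 2")
        case True
        then show ?thesis using unit[of 1] k by (simp add: D_def numeral_2_eq_2 numeral_3_eq_3)
      next
        case False
        then have l: "3 \<le> l" "l \<le> k" using less.prems by auto
        have "D l = (\<Sum>m\<in>{2..<l}. (1 + (\<Sum>q\<in>{2..<m}. B q m)) * A m l)"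
          unfolding Drec[OF l] by (rule sum.cong) (use less l in auto)
        also have "\<dots> = (\<Sum>m\<in>{2..<l}. A m l) + (\<Sum>m\<in>{2..<l}. \<Sum>q\<in>{2..<m}. B q m * A m l)"
          by (simp add: distrib_right sum.distrib sum_distrib_right)
        also have "\<dots> = (\<Sum>m\<in>{2..<l}. A m l + (\<Sum>q\<in>{m<..<l}. B m q * A q l))"
          by (simp add: sum_triangle_swap sum.distrib)
        also have "\<dots> = (\<Sum>m\<in>{2..<l}. B m l + (if m = l - 1 then 1 else 0))"
          by (rule sum.cong) (use AB l in auto)
        also have "\<dots> = 1 + (\<Sum>m\<in>{2..<l}. B m l)"
          using l by (simp add: sum.distrib)
        finally show ?thesis .
      qed
    qed
    \<comment> \<open>For \<open>m < k\<close> the vertex \<open>2 * m + 1\<close> has edges to both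
      vertices of the last pair; the two flatness equations are subtracted.\<close>
    have E: "E m + (\<Sum>l\<in>{m<..<k + 1}. B m l * E l) = (if m = k then 1 else 0)"
      if "2 \<le> m" "m \<le> k" for m
    proof (cases "m = k")
      case True
      have "{m<..<k + 1} = {}" using True by auto
      then show ?thesis using unit[of k] k True by (simp add: E_def)
    next
      case False
      have eq: "{m<..<Suc k} = {m<..k}" by auto
      have "f m (k + 1) (2 * m + 1) =
          f m (k + 1) (2 * k) + transport f m (k + 1) (2 * m + 1) (2 * k)"
        "f m (k + 1) (2 * m + 1) =
          f m (k + 1) (2 * k + 1) + transport f m (k + 1) (2 * m + 1) (2 * k + 1)"
        by (rule step; use that False in auto)+
      then have "E m = transport f m (k + 1) (2 * m + 1) (2 * k + 1) -
          transport f m (k + 1) (2 * m + 1) (2 * k)"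
        unfolding E_def diff_eq_eq by (simp add: algebra_simps)
      then show ?thesis using False
        by (simp add: eq transport_def E_def B_def right_diff_distrib sum_subtractf)
    qed
    have "(\<Sum>l\<in>{2..<k + 1}. D l * E l) = (\<Sum>l\<in>{2..<k + 1}. (1 + (\<Sum>m\<in>{2..<l}. B m l)) * E l)"
      by (rule sum.cong) (use D in auto)
    also have "\<dots> = (\<Sum>l\<in>{2..<k + 1}. E l) + (\<Sum>l\<in>{2..<k + 1}. \<Sum>m\<in>{2..<l}. B m l * E l)"
      by (simp add: distrib_right sum.distrib sum_distrib_right)
    also have "\<dots> = (\<Sum>m\<in>{2..<k + 1}. E m + (\<Sum>l\<in>{m<..<k + 1}. B m l * E l))"
      by (simp only: sum_triangle_swap sum.distrib)
    also have "\<dots> = (\<Sum>m\<in>{2..<k + 1}. if m = k then 1 else 0)"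
      by (rule sum.cong) (use E in auto)
    also have "\<dots> = 1" using k by simp
    finally have DE: "(\<Sum>l\<in>{2..<k + 1}. D l * E l) = 1" .
    have eq: "{2..<Suc k} = {Suc 0<..k}" by auto
    have "h (2 * k + 1) - h 2 + b 2 (2 * k + 1) = - (\<Sum>l\<in>{2..<k + 1}. D l * E l)"
      using k by (simp add: h_def b_def transport_def eq D_def E_def algebra_simps
          sum.distrib sum_subtractf)
    then show ?thesis using DE by simp
  qed
  ultimately show ?thesis unfolding b_def by blast
qed

section \<open>The algebra of a simplicial complex\<close>

lemma sum_apply: "(\<Sum>l\<in>S. f l) x = (\<Sum>l\<in>S. f l x)"
  by (induction S rule: infinite_finite_induct) auto

lemma R_comp_zero: "0 \<in> R_comp K n w"
  by (simp add: R_comp_def R_carrier_def)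

lemma R_comp_add: "x \<in> R_comp K n w \<Longrightarrow> y \<in> R_comp K n w \<Longrightarrow> x + y \<in> R_comp K n w"
  unfolding R_comp_def R_carrier_def by (simp add: plus_fun_def) (metis add_0)

lemma R_comp_minus: "x \<in> R_comp K n w \<Longrightarrow> - x \<in> R_comp K n w"
  by (simp add: R_comp_def R_carrier_def)

lemma R_comp_sum: "(\<And>l. l \<in> S \<Longrightarrow> x l \<in> R_comp K n w) \<Longrightarrow> sum x S \<in> R_comp K n w"
  by (induction S rule: infinite_finite_induct) (auto intro: R_comp_add R_comp_zero)

lemma R_comp_scale:
  assumes "x \<in> R_comp K n w"
  shows "(\<lambda>p. c * x p) \<in> R_comp K n w"
proof -
  have "c * x p \<noteq> 0 \<Longrightarrow> x p \<noteq> 0" for p by auto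
  then show ?thesis using assms unfolding R_comp_def R_carrier_def mem_Collect_eq by blast
qed

lemma R_diff_in_carrier: "R_diff e K x \<in> R_carrier K"
  by (auto simp: R_carrier_def R_diff_def)

lemma R_comp_D:
  assumes "x \<in> R_comp K n w" "x (J, I) \<noteq> 0"
  shows "int (card J + 2 * card I) = n" "w = (\<lambda>i. if i \<in> J \<union> I then 1 else 0)"
    "(J, I) \<in> R_basis K"
  using assms unfolding R_comp_def R_carrier_def by blast+

lemma R_diff_in_comp:
  assumes "x \<in> R_comp K n w" and fin: "finite (\<Union>K)"
  shows "R_diff e K x \<in> R_comp K (n + 1) w"
proof -
  have "int (card J + 2 * card I) = n + 1 \<and> w = (\<lambda>i. if i \<in> J \<union> I then 1 else 0)"
    if "R_diff e K x (J, I) \<noteq> 0" for J I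
  proof -
    have basis: "(J, I) \<in> R_basis K" using that by (auto simp: R_diff_def split: if_splits)
    then have "(\<Sum>i\<in>I. (-1) ^ card {p \<in> J. e p < e i} * x (insert i J, I - {i})) \<noteq> 0"
      using that by (simp add: R_diff_def)
    then obtain i where i: "i \<in> I" "x (insert i J, I - {i}) \<noteq> 0"
      by (elim sum.not_neutral_contains_not_neutral) (metis mult_zero_right)
    have "J \<subseteq> \<Union>K" "I \<subseteq> \<Union>K" "i \<notin> J" using basis i by (auto simp: R_basis_def)
    then have "finite J" "finite I" "i \<notin> J" using fin finite_subset by blast+
    then have "card (insert i J) = card J + 1" "card I = card (I - {i}) + 1"
      using i(1) card.remove[of I i] by simp_all
    moreover have "insert i J \<union> (I - {i}) = J \<union> I" using i(1) by auto
    ultimately show ?thesis using R_comp_D[OF assms(1) i(2)] by simp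
  qed
  then show ?thesis using R_diff_in_carrier[of e K x] by (simp add: R_comp_def)
qed

lemma R_mult_in_comp:
  assumes x: "x \<in> R_comp K n w" and y: "y \<in> R_comp K n' w'" and fin: "finite (\<Union>K)"
  shows "R_mult e K x y \<in> R_comp K (n + n') (w + w')"
proof -
  have "int (card J + 2 * card I) = n + n' \<and> w + w' = (\<lambda>i. if i \<in> J \<union> I then 1 else 0)"
    if "R_mult e K x y (J, I) \<noteq> 0" for J I
  proof -
    have basis: "(J, I) \<in> R_basis K" using that by (auto simp: R_mult_def split: if_splits)
    then have "(\<Sum>J1\<in>Pow J. \<Sum>I1\<in>Pow I.
        shuffle_sign e J1 (J - J1) * x (J1, I1) * y (J - J1, I - I1)) \<noteq> 0"
      using that by (simp add: R_mult_def)
    then obtain J1 I1 where 1: "J1 \<subseteq> J" "I1 \<subseteq> I"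
      "shuffle_sign e J1 (J - J1) * x (J1, I1) * y (J - J1, I - I1) \<noteq> 0"
      by (elim sum.not_neutral_contains_not_neutral) auto
    then have "x (J1, I1) \<noteq> 0" "y (J - J1, I - I1) \<noteq> 0" by auto
    note D = R_comp_D[OF x this(1)] R_comp_D[OF y this(2)]
    have disj: "J \<inter> I = {}" and "finite J" "finite I" using basis fin
      by (auto simp: R_basis_def intro: finite_subset[OF _ fin])
    then have "card J = card J1 + card (J - J1)" "card I = card I1 + card (I - I1)"
      using 1 card_Un_disjoint[of J1 "J - J1"] card_Un_disjoint[of I1 "I - I1"]
      by (simp_all add: finite_subset Un_absorb1)
    moreover have "w + w' = (\<lambda>i. if i \<in> J \<union> I then 1 else 0)"
      unfolding D(2,5) using 1 disj by (auto simp: fun_eq_iff)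
    ultimately show ?thesis using D(1,4) by simp
  qed
  moreover have "R_mult e K x y \<in> R_carrier K" by (auto simp: R_mult_def R_carrier_def)
  ultimately show ?thesis by (simp add: R_comp_def)
qed

lemma R_mono_in_comp:
  assumes "n = int (card J + 2 * card I)" "w = (\<lambda>i. if i \<in> J \<union> I then 1 else 0)"
  shows "R_mono K J I \<in> R_comp K n w"
  using assms by (auto simp: R_comp_def R_carrier_def R_mono_def)

text \<open>This is the Leibniz rule on a monomial. Terms whose set \<open>insert i I\<close> is not
  a simplex are included, since \<open>R_mono\<close> is zero for them.\<close>

lemma R_diff_mono:
  fixes K :: "'v set set" and b :: "'v set \<times> 'v set"
  assumes "(J, I) \<in> R_basis K" "finite J" "finite I"
  shows "R_diff e K (R_mono K J I) b =
    (\<Sum>i\<in>J. (-1) ^ card {p \<in> J. e p < e i} * R_mono K (J - {i}) (insert i I) b :: 'k::comm_ring_1)"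
proof (cases "b \<in> R_basis K")
  case False
  then show ?thesis by (cases b) (simp add: R_diff_def R_mono_def)
next
  case True
  obtain P Q where b: "b = (P, Q)" by (cases b)
  have disj: "J \<inter> I = {}" "P \<inter> Q = {}" using assms True by (auto simp: b R_basis_def)
  have *: "insert i P = J \<and> Q - {i} = I \<longleftrightarrow> P = J - {i} \<and> Q = insert i I" if "i \<in> Q \<and> i \<in> J" for i
    using that disj by auto
  have L: "R_diff e K (R_mono K J I) b =
      (\<Sum>i\<in>Q. (-1) ^ card {p \<in> P. e p < e i} * R_mono K J I (insert i P, Q - {i}) :: 'k)"
    using True by (simp add: b R_diff_def)
  show ?thesis
  proof (cases "finite Q")
    case False
    then have "\<forall>i. Q \<noteq> insert i I" using assms(3) by auto
    then show ?thesis using False unfolding L by (simp add: b R_mono_def)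
  next
    case fin: True
    have "R_diff e K (R_mono K J I) b =
        (\<Sum>i\<in>Q \<inter> J. (-1) ^ card {p \<in> P. e p < e i} * R_mono K J I (insert i P, Q - {i}) :: 'k)"
      unfolding L using fin by (intro sum.mono_neutral_right) (auto simp: R_mono_def)
    also have "\<dots> = (\<Sum>i\<in>Q \<inter> J. (-1) ^ card {p \<in> J. e p < e i} * R_mono K (J - {i}) (insert i I) b)"
    proof (rule sum.cong[OF refl])
      fix i assume i: "i \<in> Q \<inter> J"
      have "insert i P = J \<and> Q - {i} = I \<longleftrightarrow> P = J - {i} \<and> Q = insert i I" using * i by simp
      then have "R_mono K J I (insert i P, Q - {i}) = (R_mono K (J - {i}) (insert i I) b :: 'k)"
        using assms(1) True unfolding R_mono_def b prod.inject by metis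
      moreover have "{p \<in> P. e p < e i} = {p \<in> J. e p < e i}" if "P = J - {i}" using that by auto
      ultimately show "(-1) ^ card {p \<in> P. e p < e i} * R_mono K J I (insert i P, Q - {i}) =
          (-1) ^ card {p \<in> J. e p < e i} * (R_mono K (J - {i}) (insert i I) b :: 'k)"
        by (cases "P = J - {i}") (auto simp: b R_mono_def)
    qed
    also have "\<dots> = (\<Sum>i\<in>J. (-1) ^ card {p \<in> J. e p < e i} * R_mono K (J - {i}) (insert i I) b)"
      using assms(2) by (intro sum.mono_neutral_left) (auto simp: b R_mono_def)
    finally show ?thesis .
  qed
qed

lemma R_diff_add: "R_diff e K (x + y) = R_diff e K x + R_diff e K y"
  by (auto simp: R_diff_def fun_eq_iff sum.distrib distrib_left)

lemma R_diff_zero: "R_diff e K 0 = 0"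
  by (auto simp: R_diff_def fun_eq_iff)

lemma R_mult_minus_left: "R_mult e K (- x) y = - R_mult e K x y"
  by (auto simp: R_mult_def fun_eq_iff sum_negf)

lemma R_mult_zero_left: "R_mult e K 0 y = 0"
  by (auto simp: R_mult_def fun_eq_iff)

lemma R_mult_zero_right: "R_mult e K x 0 = 0"
  by (auto simp: R_mult_def fun_eq_iff)

lemma R_class_cong:
  assumes "a = b + R_diff e K y" "y \<in> R_carrier K"
  shows "cohom_class (R_algebra e K) a = cohom_class (R_algebra e K) b"
proof -
  have "\<exists>z'\<in>R_carrier K. a + R_diff e K z = b + R_diff e K z'" if "z \<in> R_carrier K" for z
  proof
    show "a + R_diff e K z = b + R_diff e K (y + z)"
      unfolding assms(1) R_diff_add by (simp add: add.assoc)
    show "y + z \<in> R_carrier K" using assms(2) that by (auto simp: R_carrier_def)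
  qed
  moreover have "\<exists>z'\<in>R_carrier K. b + R_diff e K z = a + R_diff e K z'" if "z \<in> R_carrier K" for z
  proof
    show "b + R_diff e K z = a + R_diff e K (z - y)"
      using R_diff_add[of e K "z - y" y] unfolding assms(1) by (simp add: algebra_simps)
    show "z - y \<in> R_carrier K" using assms(2) that by (auto simp: R_carrier_def)
  qed
  ultimately show ?thesis unfolding cohom_class_def R_algebra_def by auto
qed

section \<open>Pullback along order-preserving embeddings\<close>

lemma embedding_basis:
  assumes "simplicial_embedding j L K" "(J, I) \<in> R_basis L"
  shows "(j ` J, j ` I) \<in> R_basis K"
proof -
  have inj: "inj_on j (\<Union>L)" and simp: "\<And>\<sigma>. \<sigma> \<in> L \<Longrightarrow> j ` \<sigma> \<in> K"
    using assms(1) by (auto simp: simplicial_embedding_def)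
  have b: "J \<subseteq> \<Union>L" "I \<in> L" "J \<inter> I = {}" using assms(2) by (auto simp: R_basis_def)
  have "j ` J \<subseteq> \<Union>K" using b(1) simp by fast
  moreover have "j ` J \<inter> j ` I = j ` (J \<inter> I)"
    by (rule inj_on_image_Int[OF inj b(1), symmetric]) (use b(2) in blast)
  ultimately show ?thesis using b simp by (simp add: R_basis_def)
qed

text \<open>Agreement of the two vertex orders makes every reordering sign in
  \<open>R_pullback\<close> equal to 1 and preserves the position counts behind the signs of the
  differential.\<close>

locale monotone_embedding =
  fixes e :: "'v \<Rightarrow> nat" and e' :: "'w \<Rightarrow> nat" and L :: "'v set set" and K :: "'w set set"
    and j :: "'v \<Rightarrow> 'w"
  assumes embedding: "simplicial_embedding j L K"
    and mono: "\<And>p q. p \<in> \<Union>L \<Longrightarrow> q \<in> \<Union>L \<Longrightarrow> e p < e q \<longleftrightarrow> e' (j p) < e' (j q)"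
    and down: "\<And>\<sigma> \<tau>. \<sigma> \<in> L \<Longrightarrow> \<tau> \<subseteq> \<sigma> \<Longrightarrow> \<tau> \<in> L"
begin

lemma inj: "inj_on j (\<Union>L)"
  using embedding by (simp add: simplicial_embedding_def)

lemma pullback_apply:
  "R_pullback e e' L j x (J, I) = (if (J, I) \<in> R_basis L then x (j ` J, j ` I) else 0)"
proof -
  have none: "{(p, q). p \<in> J \<and> q \<in> J \<and> e p < e q \<and> e' (j q) < e' (j p)} = {}" if "J \<subseteq> \<Union>L"
  proof -
    have "e' (j p) < e' (j q)" if "p \<in> J" "q \<in> J" "e p < e q" for p q
      using mono[of p q] that \<open>J \<subseteq> \<Union>L\<close> by blast
    then show ?thesis using less_asym by blast
  qed
  then show ?thesis by (cases "(J, I) \<in> R_basis L") (auto simp: R_pullback_def none R_basis_def)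
qed

lemma pullback_carrier: "R_pullback e e' L j x \<in> R_carrier L"
  by (auto simp: R_carrier_def pullback_apply)

lemma pullback_add: "R_pullback e e' L j (x + y) = R_pullback e e' L j x + R_pullback e e' L j y"
  by (auto simp: fun_eq_iff pullback_apply)

text \<open>The sum over the image of \<open>I\<close> is reindexed by \<open>j\<close>, and the
  preserved order keeps each sign. Downward closure of \<open>L\<close> ensures that the shifted
  index \<open>(insert i J, I - {i})\<close> is again in the basis, so the pullback does not kill
  that term.\<close>

lemma pullback_diff: "R_pullback e e' L j (R_diff e' K x) = R_diff e L (R_pullback e e' L j x)"
proof
  fix b :: "'v set \<times> 'v set"
  obtain J I where b: "b = (J, I)" by (cases b)
  show "R_pullback e e' L j (R_diff e' K x) b = R_diff e L (R_pullback e e' L j x) b"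
  proof (cases "(J, I) \<in> R_basis L")
    case False
    then show ?thesis by (simp add: b pullback_apply R_diff_def)
  next
    case True
    then have B: "J \<subseteq> \<Union>L" "I \<in> L" "J \<inter> I = {}" by (auto simp: R_basis_def)
    then have IL: "I \<subseteq> \<Union>L" by blast
    have "R_pullback e e' L j (R_diff e' K x) b =
        (\<Sum>i\<in>j ` I. (-1) ^ card {p \<in> j ` J. e' p < e' i} * x (insert i (j ` J), j ` I - {i}))"
      using True embedding_basis[OF embedding True] by (simp add: b pullback_apply R_diff_def)
    also have "\<dots> = (\<Sum>i\<in>I. (-1) ^ card {p \<in> j ` J. e' p < e' (j i)} *
        x (insert (j i) (j ` J), j ` I - {j i}))"
      by (rule sum.reindex_cong[OF inj_on_subset[OF inj IL]]) auto
    also have "\<dots> = (\<Sum>i\<in>I. (-1) ^ card {p \<in> J. e p < e i} *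
        R_pullback e e' L j x (insert i J, I - {i}))"
    proof (rule sum.cong[OF refl])
      fix i assume i: "i \<in> I"
      then have iL: "i \<in> \<Union>L" using IL by blast
      have "e' (j p) < e' (j i) \<longleftrightarrow> e p < e i" if "p \<in> J" for p
        using mono[of p i] that B(1) iL by blast
      then have "{p \<in> j ` J. e' p < e' (j i)} = j ` {p \<in> J. e p < e i}" by auto
      moreover have "inj_on j {p \<in> J. e p < e i}" by (rule inj_on_subset[OF inj]) (use B(1) in blast)
      ultimately have card: "card {p \<in> j ` J. e' p < e' (j i)} = card {p \<in> J. e p < e i}"
        using card_image by metis
      have "(insert i J, I - {i}) \<in> R_basis L"
        using B iL down[OF B(2), of "I - {i}"] by (auto simp: R_basis_def)
      moreover have "j ` (I - {i}) = j ` I - {j i}"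
        using inj_on_image_set_diff[OF inj, of I "{i}"] IL iL by auto
      ultimately show "(-1) ^ card {p \<in> j ` J. e' p < e' (j i)} *
          x (insert (j i) (j ` J), j ` I - {j i}) =
          (-1) ^ card {p \<in> J. e p < e i} * R_pullback e e' L j x (insert i J, I - {i})"
        by (simp add: card pullback_apply)
    qed
    also have "\<dots> = R_diff e L (R_pullback e e' L j x) b"
      using True by (simp add: b R_diff_def)
    finally show ?thesis .
  qed
qed

text \<open>\<open>cohom_pullback\<close> is a union over all representatives. Since the pullback is
  a chain map, each of them contributes the same class.\<close>

lemma pullback_class:
  "cohom_pullback e e' L j (cohom_class (R_algebra e' K) a) =
    cohom_class (R_algebra e L) (R_pullback e e' L j a)"
proof -
  have "cohom_class (R_algebra e L) (R_pullback e e' L j x) =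
      cohom_class (R_algebra e L) (R_pullback e e' L j a)"
    if x: "x \<in> cohom_class (R_algebra e' K) a" for x
  proof -
    obtain y where "x = a + R_diff e' K y" using x by (auto simp: cohom_class_def R_algebra_def)
    then show ?thesis
      by (intro R_class_cong[of _ _ _ _ "R_pullback e e' L j y"])
        (simp_all add: pullback_add pullback_diff pullback_carrier)
  qed
  moreover have "a \<in> cohom_class (R_algebra e' K) a"
    unfolding cohom_class_def R_algebra_def dga.simps mem_Collect_eq
    by (rule exI[of _ 0]) (simp add: R_diff_zero R_carrier_def)
  ultimately show ?thesis unfolding cohom_pullback_def by blast
qed

lemma pullback_mono:
  assumes "(J0, I0) \<in> R_basis L"
  shows "R_pullback e e' L j (R_mono K (j ` J0) (j ` I0)) = R_mono L J0 I0"
proof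
  fix b :: "'v set \<times> 'v set"
  obtain J I where b: "b = (J, I)" by (cases b)
  show "R_pullback e e' L j (R_mono K (j ` J0) (j ` I0)) b = R_mono L J0 I0 b"
  proof (cases "(J, I) \<in> R_basis L")
    case True
    then have "J \<subseteq> \<Union>L" "I \<subseteq> \<Union>L" "J0 \<subseteq> \<Union>L" "I0 \<subseteq> \<Union>L"
      using assms by (auto simp: R_basis_def)
    then have "j ` J = j ` J0 \<longleftrightarrow> J = J0" "j ` I = j ` I0 \<longleftrightarrow> I = I0"
      using inj_on_image_eq_iff[OF inj] by blast+
    then show ?thesis
      using True embedding_basis[OF embedding True] by (simp add: b pullback_apply R_mono_def)
  next
    case False
    then show ?thesis by (simp add: b pullback_apply R_mono_def)
  qed
qed

end

section \<open>Massey products of non-adjacent pairs\<close>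

lemma signs_cancel: "(-1) ^ s * (-1) ^ t * x = 0 \<longleftrightarrow> x = (0::'a::comm_ring_1)"
  by (simp add: minus_one_power_iff)

text \<open>Each \<open>v (2 * i)\<close>, \<open>v (2 * i + 1)\<close> with \<open>1 \<le> i \<le> k\<close> is one of the non-adjacent pairs.\<close>

locale massey_configuration =
  fixes K :: "'v set set" and e :: "'v \<Rightarrow> nat" and v :: "nat \<Rightarrow> 'v" and k :: nat
  assumes two_le: "2 \<le> k"
    and fin: "finite (\<Union>K)"
    and down: "\<And>\<sigma> \<tau>. \<sigma> \<in> K \<Longrightarrow> \<tau> \<subseteq> \<sigma> \<Longrightarrow> \<tau> \<in> K"
    and order: "\<And>s t. 2 \<le> s \<Longrightarrow> s < t \<Longrightarrow> t \<le> 2 * k + 1 \<Longrightarrow> e (v s) < e (v t)"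
    and vertex: "\<And>t. 2 \<le> t \<Longrightarrow> t \<le> 2 * k + 1 \<Longrightarrow> {v t} \<in> K"
    and edge: "\<And>s t. 2 \<le> s \<Longrightarrow> s < t \<Longrightarrow> t \<le> 2 * k + 1 \<Longrightarrow>
      {v s, v t} \<in> K \<longleftrightarrow> odd s \<or> even t \<or> (s = 2 \<and> t = 2 * k + 1)"
begin

abbreviation block :: "nat \<Rightarrow> nat \<Rightarrow> 'v set" where
  "block i j \<equiv> v ` {2 * i..<2 * j}"

abbreviation weight :: "nat \<Rightarrow> 'v \<Rightarrow> nat" where
  "weight i \<equiv> (\<lambda>x. if x \<in> {v (2 * i), v (2 * i + 1)} then 1 else 0)"

abbreviation factor :: "nat \<Rightarrow> ('v set \<times> 'v set \<Rightarrow> 'k::comm_ring_1) set" where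
  "factor i \<equiv> cohom_class (R_algebra e K) (R_mono K {v (2 * i + 1)} {v (2 * i)})"

text \<open>The indicator cochain of the exceptional edge; all other vertices of the pairs enter as
  exterior factors.\<close>

abbreviation diagonal :: "'v set \<times> 'v set \<Rightarrow> 'k::comm_ring_1" where
  "diagonal \<equiv> R_mono K (block 1 (k + 1) - {v 2, v (2 * k + 1)}) {v 2, v (2 * k + 1)}"

text \<open>Up to sign, the value at \<open>v t\<close> of the 0-cochain on the block that is
  encoded in \<open>x\<close>.\<close>

abbreviation coef :: "('v set \<times> 'v set \<Rightarrow> 'k::comm_ring_1) \<Rightarrow> nat \<Rightarrow> nat \<Rightarrow> nat \<Rightarrow> 'k" where
  "coef x i j t \<equiv> x (block i j - {v t}, {v t})"

section \<open>Vertex order and blocks of pairs\<close>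

lemma order_iff:
  assumes "s \<in> {2..2 * k + 1}" "t \<in> {2..2 * k + 1}"
  shows "e (v s) < e (v t) \<longleftrightarrow> s < t"
  using assms by (metis atLeastAtMost_iff linorder_neqE_nat order less_asym less_irrefl)

lemma inj: "inj_on v {2..2 * k + 1}"
proof (rule linorder_inj_onI)
  fix s t assume "s < t" "s \<in> {2..2 * k + 1}" "t \<in> {2..2 * k + 1}"
  then show "v s \<noteq> v t" using order[of s t] by force
qed auto

lemma inj_block: "1 \<le> i \<Longrightarrow> j \<le> k + 1 \<Longrightarrow> inj_on v {2 * i..<2 * j}"
  by (rule inj_on_subset[OF inj]) auto

lemma v_eq_iff: "s \<in> {2..2 * k + 1} \<Longrightarrow> t \<in> {2..2 * k + 1} \<Longrightarrow> v s = v t \<longleftrightarrow> s = t"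
  by (rule inj_on_eq_iff[OF inj])

lemma block_diff:
  assumes "1 \<le> i" "j \<le> k + 1" "S \<subseteq> {2 * i..<2 * j}"
  shows "block i j - v ` S = v ` ({2 * i..<2 * j} - S)"
  by (rule inj_on_image_set_diff[OF inj_block[OF assms(1,2)] _ assms(3), symmetric]) simp

lemma card_block: "1 \<le> i \<Longrightarrow> j \<le> k + 1 \<Longrightarrow> card (block i j) = 2 * (j - i)"
  by (simp add: card_image[OF inj_block] diff_mult_distrib2)

lemma block_subset: "1 \<le> i \<Longrightarrow> j \<le> k + 1 \<Longrightarrow> block i j \<subseteq> \<Union>K"
proof
  fix x assume "1 \<le> i" "j \<le> k + 1" "x \<in> block i j"
  then obtain t where "x = v t" "2 \<le> t" "t \<le> 2 * k + 1" by auto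
  then show "x \<in> \<Union>K" using vertex[of t] by blast
qed

lemma card_before:
  assumes "S \<subseteq> {2..2 * k + 1}" "t \<in> {2..2 * k + 1}"
  shows "card {p \<in> v ` S. e p < e (v t)} = card {u \<in> S. u < t}"
proof -
  have "e (v u) < e (v t) \<longleftrightarrow> u < t" if "u \<in> S" for u
    using order_iff[of u t] assms that by blast
  then have "{p \<in> v ` S. e p < e (v t)} = v ` {u \<in> S. u < t}" by auto
  moreover have "inj_on v {u \<in> S. u < t}" by (rule inj_on_subset[OF inj]) (use assms(1) in auto)
  ultimately show ?thesis using card_image by metis
qed

lemma sum_weight:
  assumes "i \<le> j" "1 \<le> i" "j \<le> k + 1"
  shows "(\<Sum>l\<in>{i..<j}. weight l) = (\<lambda>x. if x \<in> block i j then 1 else 0)"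
  using assms
proof (induction j rule: dec_induct)
  case base
  then show ?case by (simp add: fun_eq_iff)
next
  case (step j)
  have "{2 * i..<2 * Suc j} = {2 * i..<2 * j} \<union> {2 * j, 2 * j + 1}" using step by auto
  then have "block i (Suc j) = block i j \<union> {v (2 * j), v (2 * j + 1)}" by auto
  moreover have "v (2 * j) \<notin> block i j" "v (2 * j + 1) \<notin> block i j"
    using step by (auto simp: v_eq_iff image_iff)
  ultimately show ?case using step by (auto simp: fun_eq_iff)
qed

section \<open>Supports and coefficients on edges\<close>

lemma entry_degree_const:
  assumes "i < j"
  shows "entry_degree (\<lambda>_. 3) i j = 2 * int (j - i) + 1"
  using assms by (simp add: entry_degree_def of_nat_diff)

text \<open>The weight forces \<open>J\<close> and \<open>I\<close> to partition the block. As
  exterior factors have degree 1 and polynomial factors degree 2, the total degree then fixes the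
  cardinality of \<open>I\<close>.\<close>

lemma support_union:
  assumes "x \<in> R_comp K n (\<Sum>l\<in>{i..<j}. weight l)" "i \<le> j" "1 \<le> i" "j \<le> k + 1" "x (J, I) \<noteq> 0"
  shows "J = block i j - I" "I \<subseteq> block i j" "2 * int (j - i) + int (card I) = n" "I \<in> K"
proof -
  note D = R_comp_D[OF assms(1,5)]
  have "(\<lambda>x. if x \<in> block i j then 1 else 0) = (\<lambda>x. if x \<in> J \<union> I then 1 else (0::nat))"
    using D(2) sum_weight[OF assms(2-4)] by simp
  then have "x \<in> block i j \<longleftrightarrow> x \<in> J \<union> I" for x
    by (metis (mono_tags) zero_neq_one)
  then have JI: "J \<union> I = block i j" by blast
  moreover have disj: "J \<inter> I = {}" "I \<in> K" using D(3) by (auto simp: R_basis_def)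
  moreover have "finite J" "finite I" using JI by (metis finite_Un finite_atLeastLessThan finite_imageI)+
  then have "card J + card I = 2 * (j - i)"
    using card_Un_disjoint[of J I] disj JI card_block[OF assms(3,4)] by simp
  ultimately show "J = block i j - I" "I \<subseteq> block i j" "2 * int (j - i) + int (card I) = n" "I \<in> K"
    using D(1) by auto
qed

text \<open>In the degree of a defining system entry exactly one polynomial factor remains, so an
  entry is a function on the vertices of its block.\<close>

lemma entry_support:
  assumes "x \<in> R_comp K (entry_degree (\<lambda>_. 3) i j) (\<Sum>l\<in>{i..<j}. weight l)"
    and "i < j" "1 \<le> i" "j \<le> k + 1" "x (J, I) \<noteq> 0"
  shows "\<exists>t\<in>{2 * i..<2 * j}. J = block i j - {v t} \<and> I = {v t}"
proof -
  note S = support_union[OF assms(1) less_imp_le[OF assms(2)] assms(3-5)]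
  then have "card I = 1" using entry_degree_const[OF assms(2)] by simp
  then obtain y where "I = {y}" by (auto simp: card_1_singleton_iff)
  then show ?thesis using S(1,2) by auto
qed

lemma R_basis_edge:
  assumes "1 \<le> i" "j \<le> k + 1" "{v s, v t} \<in> K"
  shows "(block i j - {v s, v t}, {v s, v t}) \<in> R_basis K"
  using block_subset[OF assms(1,2)] assms(3) unfolding R_basis_def by blast

lemma diff_coef:
  fixes x :: "'v set \<times> 'v set \<Rightarrow> 'k::comm_ring_1"
  assumes ij: "1 \<le> i" "j \<le> k + 1" and st: "2 * i \<le> s" "s < t" "t < 2 * j" and K: "{v s, v t} \<in> K"
  shows "R_diff e K x (block i j - {v s, v t}, {v s, v t}) =
    (-1) ^ s * coef x i j t - (-1) ^ t * coef x i j s"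
proof -
  have mem: "s \<in> {2..2 * k + 1}" "t \<in> {2..2 * k + 1}" using assms by auto
  have ne: "v s \<noteq> v t" using mem st by (simp add: v_eq_iff)
  have in_block: "v s \<in> block i j" "v t \<in> block i j" using st by auto
  define S where "S = {2 * i..<2 * j} - {s, t}"
  have block: "block i j - {v s, v t} = v ` S"
    using block_diff[OF ij, of "{s, t}"] st by (auto simp: S_def)
  have S: "S \<subseteq> {2..2 * k + 1}" using ij by (auto simp: S_def)
  \<comment> \<open>Removing \<open>s\<close> and \<open>t\<close> lowers the position of
    \<open>t\<close> by one but leaves that of \<open>s\<close> unchanged. This produces the
    relative minus sign.\<close>
  have "{u \<in> S. u < s} = {2 * i..<s}" "{u \<in> S. u < t} = {2 * i..<t} - {s}"
    using st by (auto simp: S_def)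
  then have "card {p \<in> v ` S. e p < e (v s)} = s - 2 * i"
    "card {p \<in> v ` S. e p < e (v t)} = t - 2 * i - 1"
    using card_before[OF S] mem st by simp_all
  moreover have "even (s - 2 * i) \<longleftrightarrow> even s" "even (t - 2 * i - 1) \<longleftrightarrow> odd t"
    using st by presburger+
  ultimately have sign: "(-1) ^ card {p \<in> v ` S. e p < e (v s)} = ((-1) ^ s :: 'k)"
    "(-1) ^ card {p \<in> v ` S. e p < e (v t)} = (- ((-1) ^ t) :: 'k)"
    by (simp_all add: minus_one_power_iff)
  have ins: "insert (v s) (block i j - {v s, v t}) = block i j - {v t}"
    "insert (v t) (block i j - {v s, v t}) = block i j - {v s}"
    "{v s, v t} - {v s} = {v t}" "{v s, v t} - {v t} = {v s}"
    using ne in_block by auto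
  have "R_diff e K x (block i j - {v s, v t}, {v s, v t}) =
      (\<Sum>y\<in>{v s, v t}. (-1) ^ card {p \<in> v ` S. e p < e y} *
        x (insert y (block i j - {v s, v t}), {v s, v t} - {y}))"
    using R_basis_edge[OF ij K] by (simp add: R_diff_def flip: block)
  also have "\<dots> = (-1) ^ s * coef x i j t - (-1) ^ t * coef x i j s"
    using ne by (simp add: ins sign)
  finally show ?thesis .
qed

text \<open>Degrees and weights allow only one splitting, with one polynomial factor in each block,
  so the cut \<open>l\<close> must separate \<open>s\<close> from \<open>t\<close>. The left block
  precedes the right one in the numbering, hence no shuffle sign appears.\<close>

lemma mult_coef:
  fixes x y :: "'v set \<times> 'v set \<Rightarrow> 'k::comm_ring_1"
  assumes il: "1 \<le> i" "i < l" and lj: "l < j" "j \<le> k + 1"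
    and st: "2 * i \<le> s" "s < t" "t < 2 * j" and K: "{v s, v t} \<in> K"
    and x: "x \<in> R_comp K (entry_degree (\<lambda>_. 3) i l) (\<Sum>m\<in>{i..<l}. weight m)"
    and y: "y \<in> R_comp K (entry_degree (\<lambda>_. 3) l j) (\<Sum>m\<in>{l..<j}. weight m)"
  shows "R_mult e K x y (block i j - {v s, v t}, {v s, v t}) =
    (if s < 2 * l \<and> 2 * l \<le> t then coef x i l s * coef y l j t else 0)"
proof -
  define J where "J = block i j - {v s, v t}"
  define I where "I = {v s, v t}"
  define C where "C \<longleftrightarrow> s < 2 * l \<and> 2 * l \<le> t"
  have mem: "s \<in> {2..2 * k + 1}" "t \<in> {2..2 * k + 1}" using assms by auto
  have ne: "v s \<noteq> v t" using mem st by (simp add: v_eq_iff)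
  have l: "1 \<le> l" "l \<le> k + 1" using il lj by auto
  have disj: "block i l \<inter> block l j = {}"
    using il lj by (auto simp: v_eq_iff)
  have union: "block i j = block i l \<union> block l j"
    unfolding image_Un[symmetric] using il lj by (intro arg_cong[where f = "image v"]) auto
  have summand: "shuffle_sign e J1 (J - J1) * x (J1, I1) * y (J - J1, I - I1) =
      (if I1 = {v s} then if J1 = block i l - {v s} \<and> C then coef x i l s * coef y l j t else 0 else 0)"
    if "J1 \<subseteq> J" "I1 \<subseteq> I" for J1 I1
  proof (cases "x (J1, I1) = 0 \<or> y (J - J1, I - I1) = 0")
    case False
    obtain u where u: "u \<in> {2 * i..<2 * l}" "J1 = block i l - {v u}" "I1 = {v u}"
      using entry_support[OF x il(2,1)] l False by blast
    obtain w where w: "w \<in> {2 * l..<2 * j}" "J - J1 = block l j - {v w}" "I - I1 = {v w}"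
      using entry_support[OF y lj(1) _ lj(2)] l False by blast
    have "u \<in> {2..2 * k + 1}" "w \<in> {2..2 * k + 1}" using u(1) w(1) il lj by auto
    moreover have "{v u, v w} = {v s, v t}" using u(3) w(3) that(2) unfolding I_def by auto
    ultimately have "u = s \<and> w = t \<or> u = t \<and> w = s"
      using mem by (auto simp: doubleton_eq_iff v_eq_iff)
    then have uw: "u = s" "w = t" using u(1) w(1) st by auto
    have none: "{(p, q). p \<in> block i l - {v s} \<and> q \<in> block l j - {v t} \<and> e q < e p} = {}"
      using il lj by (auto simp: order_iff)
    have "shuffle_sign e J1 (J - J1) = (1::'k)"
      unfolding w(2) unfolding u(2) uw shuffle_sign_def none by simp
    then show ?thesis using u w uw unfolding C_def by auto
  next
    \<comment> \<open>The claimed value must vanish too: at the one matching splitting, the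
      complements are \<open>block l j - {v t}\<close> and \<open>{v t}\<close>, so one of the two
      coefficients on the right is the vanishing factor.\<close>
    case True
    have "x (J1, I1) = coef x i l s \<and> y (J - J1, I - I1) = coef y l j t"
      if "I1 = {v s}" "J1 = block i l - {v s}" C
    proof -
      have "v t \<notin> block i l" "v s \<notin> block l j"
        using that(3) mem il lj by (auto simp: C_def v_eq_iff)
      moreover have "v t \<in> block l j" "v s \<in> block i l" using that(3) st by (auto simp: C_def)
      ultimately have "J - J1 = block l j - {v t}" "I - I1 = {v t}"
        unfolding J_def I_def that union using disj ne by blast+
      then show ?thesis using that by simp
    qed
    then show ?thesis using True by auto
  qed
  have finJ: "finite J" "finite I" by (simp_all add: J_def I_def)
  have "R_mult e K x y (J, I) = (\<Sum>J1\<in>Pow J. \<Sum>I1\<in>Pow I.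
      shuffle_sign e J1 (J - J1) * x (J1, I1) * y (J - J1, I - I1))"
    using R_basis_edge[OF il(1) lj(2) K] by (simp add: R_mult_def J_def I_def)
  also have "\<dots> = (\<Sum>J1\<in>Pow J. \<Sum>I1\<in>Pow I. if I1 = {v s} then
      if J1 = block i l - {v s} \<and> C then coef x i l s * coef y l j t else 0 else 0)"
    by (intro sum.cong refl summand) auto
  also have "\<dots> = (\<Sum>J1\<in>Pow J. if J1 = block i l - {v s} then
      if C then coef x i l s * coef y l j t else 0 else 0)"
    by (intro sum.cong refl, subst sum.delta) (use finJ in \<open>auto simp: I_def\<close>)
  also have "\<dots> = (if C then coef x i l s * coef y l j t else 0)"
  proof -
    have "block i l - {v s} \<subseteq> J" if C
    proof -
      have "v t \<notin> block i l" using that mem il lj by (auto simp: C_def v_eq_iff)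
      then show ?thesis unfolding J_def union by blast
    qed
    then show ?thesis using finJ by (subst sum.delta) auto
  qed
  finally show ?thesis by (simp add: J_def I_def C_def)
qed

section \<open>The Maurer-Cartan equation and the standard defining system\<close>

lemma system_iff:
  "defining_system (R_algebra e K) k (\<lambda>_. 3) W \<alpha> c a \<longleftrightarrow>
     (\<forall>i\<in>{1..k+1}. \<forall>j\<in>{1..k+1}. i \<ge> j \<longrightarrow> c i j = 0) \<and>
     (\<forall>i\<in>{1..k+1}. \<forall>j\<in>{1..k+1}. i < j \<longrightarrow>
        c i j \<in> R_comp K (entry_degree (\<lambda>_. 3) i j) (\<Sum>l\<in>{i..<j}. W l)) \<and>
     (\<forall>i\<in>{1..k}. c i (i+1) \<in> \<alpha> i) \<and> a \<in> R_carrier K \<and>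
     (\<forall>i\<in>{1..k+1}. \<forall>j\<in>{1..k+1}. (if i = 1 \<and> j = k+1 then a else 0) =
        R_diff e K (c i j) + (\<Sum>l\<in>{i<..<j}. R_mult e K (c i l) (c l j)))"
proof -
  \<comment> \<open>All entries above the diagonal have odd degree, so each bar is a minus sign;
    triangularity restricts the sum to \<open>i < l\<close> and \<open>l < j\<close>.\<close>
  have "(\<Sum>l\<in>{1..k+1}. R_mult e K (entry_bar (\<lambda>_. 3) c i l) (c l j)) =
      - (\<Sum>l\<in>{i<..<j}. R_mult e K (c i l) (c l j))"
    if zero: "\<forall>i\<in>{1..k+1}. \<forall>j\<in>{1..k+1}. i \<ge> j \<longrightarrow> c i j = 0"
      and ij: "i \<in> {1..k+1}" "j \<in> {1..k+1}" for i j
  proof -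
    have "R_mult e K (entry_bar (\<lambda>_. 3) c i l) (c l j) = 0" if "l \<in> {1..k+1} - {i<..<j}" for l
    proof (cases "l \<le> i")
      case True
      then have "c i l = 0" using zero ij that by auto
      then show ?thesis by (simp add: entry_bar_def R_mult_zero_left)
    next
      case False
      then have "c l j = 0" using zero ij that by auto
      then show ?thesis by (simp add: R_mult_zero_right)
    qed
    then have "(\<Sum>l\<in>{1..k+1}. R_mult e K (entry_bar (\<lambda>_. 3) c i l) (c l j)) =
        (\<Sum>l\<in>{i<..<j}. R_mult e K (entry_bar (\<lambda>_. 3) c i l) (c l j))"
      using ij by (intro sum.mono_neutral_right) auto
    also have "\<dots> = (\<Sum>l\<in>{i<..<j}. - R_mult e K (c i l) (c l j))"
      by (intro sum.cong refl) (simp add: entry_bar_def entry_degree_const R_mult_minus_left)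
    finally show ?thesis by (simp add: sum_negf)
  qed
  then show ?thesis
    unfolding defining_system_def R_algebra_def dga.simps by (simp cong: conj_cong)
qed

text \<open>Edges from \<open>v (2 * i)\<close> to later vertices of the block end at even vertices,
  apart from the exceptional edge. There are \<open>t - 2 * i - 1\<close> exterior factors before
  \<open>v t\<close>, which gives -1 for even \<open>t\<close> and +1 for the exceptional
  edge.\<close>

lemma diff_standard:
  assumes ij: "1 \<le> i" "i < j" "j \<le> k + 1"
  shows "R_diff e K (R_mono K (block i j - {v (2 * i)}) {v (2 * i)}) =
    (if i = 1 \<and> j = k + 1 then diagonal else 0) -
    (\<Sum>l\<in>{i<..<j}. R_mono K (block i j - {v (2 * i), v (2 * l)}) {v (2 * i), v (2 * l)}
      :: 'v set \<times> 'v set \<Rightarrow> 'k::comm_ring_1)"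
    (is "R_diff e K ?m = ?d - ?s")
proof
  fix b
  define S where "S = {2 * i<..<2 * j}"
  define g :: "nat \<Rightarrow> 'k" where "g t = R_mono K (block i j - {v (2 * i), v t}) {v (2 * i), v t} b" for t :: nat
  have S: "S \<subseteq> {2..2 * k + 1}" using ij by (auto simp: S_def)
  have "{2 * i..<2 * j} - {2 * i} = S" by (auto simp: S_def)
  then have block: "block i j - {v (2 * i)} = v ` S"
    using block_diff[of i j "{2 * i}"] ij by simp
  have "(block i j - {v (2 * i)}, {v (2 * i)}) \<in> R_basis K"
    using block_subset[of i j] vertex[of "2 * i"] ij unfolding R_basis_def by auto
  then have "R_diff e K ?m b = (\<Sum>y\<in>v ` S. (-1) ^ card {p \<in> v ` S. e p < e y} *
      R_mono K (v ` S - {y}) {y, v (2 * i)} b)"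
    unfolding block by (subst R_diff_mono) (simp_all add: S_def)
  also have "\<dots> = (\<Sum>t\<in>S. (-1) ^ card {p \<in> v ` S. e p < e (v t)} *
      R_mono K (v ` S - {v t}) {v t, v (2 * i)} b)"
    by (rule sum.reindex_cong[OF inj_on_subset[OF inj S]]) auto
  also have "\<dots> = (\<Sum>t\<in>S. (if even t then - g t else 0) +
      (if t = 2 * k + 1 then ?d b else 0))"
  proof (rule sum.cong[OF refl])
    fix t assume t: "t \<in> S"
    then have mem: "t \<in> {2..2 * k + 1}" using S by auto
    have "{u \<in> S. u < t} = {2 * i<..<t}" using t by (auto simp: S_def)
    then have "card {p \<in> v ` S. e p < e (v t)} = t - 2 * i - 1"
      using card_before[OF S mem] by simp
    moreover have "2 * i < t" using t by (simp add: S_def)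
    then have "even (t - 2 * i - 1) \<longleftrightarrow> odd t" by presburger
    ultimately have "(-1) ^ card {p \<in> v ` S. e p < e (v t)} = (if odd t then 1 else - 1 :: 'k)"
      by (simp add: minus_one_power_iff)
    moreover have "R_mono K (v ` S - {v t}) {v t, v (2 * i)} b = g t"
      unfolding g_def block[symmetric] by (simp add: insert_commute Diff_insert2 [symmetric])
    \<comment> \<open>The vertex \<open>2 * k + 1\<close> occurs only for \<open>j = k + 1\<close>.
      For \<open>i = 1\<close> this term is the diagonal; for larger \<open>i\<close> the edge is
      missing and both sides vanish.\<close>
    moreover have "g t = ?d b" if "t = 2 * k + 1"
    proof (cases "i = 1 \<and> j = k + 1")
      case True
      then show ?thesis by (simp add: g_def that)
    next
      case False
      then have "i \<noteq> 1" using t ij that by (auto simp: S_def)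
      then have "{v (2 * i), v t} \<notin> K" using edge[of "2 * i" t] ij t mem that by (auto simp: S_def)
      then show ?thesis using \<open>i \<noteq> 1\<close> by (auto simp: g_def R_mono_def R_basis_def)
    qed
    moreover have "g t = 0" if "odd t" "t \<noteq> 2 * k + 1"
    proof -
      have "{v (2 * i), v t} \<notin> K" using edge[of "2 * i" t] ij t mem that by (auto simp: S_def)
      then show ?thesis by (auto simp: g_def R_mono_def R_basis_def)
    qed
    ultimately show "(-1) ^ card {p \<in> v ` S. e p < e (v t)} *
        R_mono K (v ` S - {v t}) {v t, v (2 * i)} b =
        (if even t then - g t else 0) + (if t = 2 * k + 1 then ?d b else 0)"
      by (cases "t = 2 * k + 1") auto
  qed
  also have "\<dots> = (\<Sum>t\<in>S. if even t then - g t else 0) + (\<Sum>t\<in>S. if t = 2 * k + 1 then ?d b else 0)"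
    by (rule sum.distrib)
  also have "(\<Sum>t\<in>S. if t = 2 * k + 1 then ?d b else 0) = ?d b"
    using ij two_le by (subst sum.delta) (auto simp: S_def)
  also have "(\<Sum>t\<in>S. if even t then - g t else 0) = (\<Sum>t\<in>{t \<in> S. even t}. - g t)"
    by (rule sum.inter_filter[symmetric]) (simp add: S_def)
  also have "\<dots> = (\<Sum>l\<in>{i<..<j}. - g (2 * l))"
    by (rule sum.reindex_bij_witness[of _ "\<lambda>l. 2 * l" "\<lambda>t. t div 2"]) (auto simp: S_def)
  finally show "R_diff e K ?m b = (?d - ?s) b"
    by (simp add: g_def sum_negf sum_apply)
qed

text \<open>These products are exactly the even terms in \<open>diff_standard\<close>, with the
  opposite sign, so the two cancel in the Maurer-Cartan equation.\<close>

lemma mult_standard: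
  assumes "1 \<le> i" "i < l" "l < j" "j \<le> k + 1"
  shows "R_mult e K (R_mono K (block i l - {v (2 * i)}) {v (2 * i)})
      (R_mono K (block l j - {v (2 * l)}) {v (2 * l)}) =
    (R_mono K (block i j - {v (2 * i), v (2 * l)}) {v (2 * i), v (2 * l)}
      :: 'v set \<times> 'v set \<Rightarrow> 'k::comm_ring_1)"
proof -
  have disj: "block i l \<inter> block l j = {}" using assms by (auto simp: v_eq_iff)
  have union: "block i j = block i l \<union> block l j"
    unfolding image_Un[symmetric] using assms by (intro arg_cong[where f = "image v"]) auto
  have mem: "v (2 * i) \<in> block i l" "v (2 * l) \<in> block l j" using assms by auto
  have none: "{(p, q). p \<in> block i l - {v (2 * i)} \<and> q \<in> block l j - {v (2 * l)} \<and> e q < e p} = {}"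
    using assms by (auto simp: order_iff)
  have sign: "shuffle_sign e (block i l - {v (2 * i)}) (block l j - {v (2 * l)}) = (1::'k)"
    unfolding shuffle_sign_def none by simp
  have "(A - {a}) \<inter> (B - {b}) = {} \<and> {a} \<inter> {b} = {} \<and>
      (A - {a}) \<union> (B - {b}) = A \<union> B - {a, b} \<and> {a} \<union> {b} = {a, b}"
    if "A \<inter> B = {}" "a \<in> A" "b \<in> B" for A B and a b :: 'v
    using that by blast
  note sets = this[OF disj mem, folded union]
  show ?thesis
    by (rule trans[OF R_mult_mono]) (fact fin, rule down, assumption+, simp only: sign sets simp_thms if_True mult_1_left)
qed

lemma block_Suc: "block i (i + 1) = {v (2 * i), v (2 * i + 1)}"
proof -
  have "{2 * i..<2 * (i + 1)} = {2 * i, 2 * i + 1}" by auto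
  then show ?thesis by simp
qed

text \<open>The differential of the representative could only be supported on the pair itself, which
  is not an edge.\<close>

lemma factor_in_cohomology:
  assumes "i \<in> {1..k}"
  shows "(factor i :: ('v set \<times> 'v set \<Rightarrow> 'k::comm_ring_1) set) \<in>
    cohomology (R_algebra e K) 3 (weight i)"
proof -
  have basis: "({v (2 * i + 1)}, {v (2 * i)}) \<in> R_basis K"
    using assms vertex[of "2 * i"] vertex[of "2 * i + 1"] by (auto simp: R_basis_def v_eq_iff)
  have "{v (2 * i), v (2 * i + 1)} \<notin> K" using edge[of "2 * i" "2 * i + 1"] assms two_le by auto
  then have "R_mono K {} {v (2 * i + 1), v (2 * i)} b = (0::'k)" for b
    by (auto simp: R_mono_def R_basis_def insert_commute)
  then have "R_diff e K (R_mono K {v (2 * i + 1)} {v (2 * i)}) b = (0::'k)" for b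
    by (subst R_diff_mono[OF basis]) simp_all
  then have "R_diff e K (R_mono K {v (2 * i + 1)} {v (2 * i)}) = (0::_ \<Rightarrow> 'k)" by (simp add: fun_eq_iff)
  moreover have "R_mono K {v (2 * i + 1)} {v (2 * i)} \<in> (R_comp K 3 (weight i) :: (_ \<Rightarrow> 'k) set)"
    by (rule R_mono_in_comp) auto
  ultimately show ?thesis unfolding cohomology_def R_algebra_def by auto
qed

lemma diagonal_in_comp:
  "diagonal \<in> R_comp K (2 * int k + 2) (\<Sum>l\<in>{1..<k + 1}. weight l)"
proof (rule R_mono_in_comp)
  have sub: "{v 2, v (2 * k + 1)} \<subseteq> block 1 (k + 1)" using two_le by auto
  have "card {v 2, v (2 * k + 1)} = 2" using two_le by (simp add: v_eq_iff)
  then show "2 * int k + 2 = int (card (block 1 (k + 1) - {v 2, v (2 * k + 1)}) + 2 * card {v 2, v (2 * k + 1)})"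
    using card_block[of 1 "k + 1"] card_Diff_subset[OF _ sub] two_le by simp
  have "block 1 (k + 1) - {v 2, v (2 * k + 1)} \<union> {v 2, v (2 * k + 1)} = block 1 (k + 1)"
    using sub by blast
  then show "(\<Sum>l\<in>{1..<k + 1}. weight l) = (\<lambda>i. if i \<in> block 1 (k + 1) - {v 2, v (2 * k + 1)} \<union> {v 2, v (2 * k + 1)}
      then 1 else 0)"
    using sum_weight[of 1 "k + 1"] by (simp only:)
qed

lemma diagonal_coef:
  assumes "2 \<le> s" "s < t" "t \<le> 2 * k + 1" "{v s, v t} \<in> K"
  shows "diagonal (block 1 (k + 1) - {v s, v t}, {v s, v t}) = (if s = 2 \<and> t = 2 * k + 1 then 1 else 0)"
proof -
  have "{v s, v t} = {v 2, v (2 * k + 1)} \<longleftrightarrow> s = 2 \<and> t = 2 * k + 1"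
    using assms two_le by (auto simp: doubleton_eq_iff v_eq_iff)
  then show ?thesis using R_basis_edge[of 1 "k + 1" s t] assms(4) by (auto simp: R_mono_def)
qed

text \<open>Each entry is the indicator of the first vertex of its block. The products cancel its
  coboundary except on the exceptional edge, which lies only in the full block.\<close>

lemma standard_system:
  "defining_system (R_algebra e K) k (\<lambda>_. 3) weight factor
     (\<lambda>i j. if i < j then R_mono K (block i j - {v (2 * i)}) {v (2 * i)} else 0)
     (diagonal :: 'v set \<times> 'v set \<Rightarrow> 'k::comm_ring_1)"
  unfolding system_iff
proof (intro conjI ballI impI)
  fix i j assume ij: "i \<in> {1..k+1}" "j \<in> {1..k+1}" "i < j"
  have card: "card (block i j - {v (2 * i)}) = 2 * (j - i) - 1"
    using card_block[of i j] ij by (simp add: card_Diff_singleton)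
  have "(R_mono K (block i j - {v (2 * i)}) {v (2 * i)} :: _ \<Rightarrow> 'k) \<in>
      R_comp K (entry_degree (\<lambda>_. 3) i j) (\<Sum>l\<in>{i..<j}. weight l)"
  proof (rule R_mono_in_comp)
    show "entry_degree (\<lambda>_. 3) i j = int (card (block i j - {v (2 * i)}) + 2 * card {v (2 * i)})"
      using ij by (simp add: card entry_degree_const of_nat_diff)
    show "(\<Sum>l\<in>{i..<j}. weight l) = (\<lambda>x. if x \<in> block i j - {v (2 * i)} \<union> {v (2 * i)} then 1 else 0)"
      using sum_weight[of i j] ij by (auto simp: fun_eq_iff)
  qed
  then show "(if i < j then R_mono K (block i j - {v (2 * i)}) {v (2 * i)} else 0 :: _ \<Rightarrow> 'k) \<in>
      R_comp K (entry_degree (\<lambda>_. 3) i j) (\<Sum>l\<in>{i..<j}. weight l)"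
    using ij by simp
next
  fix i assume i: "i \<in> {1..k}"
  have "block i (i + 1) - {v (2 * i)} = {v (2 * i + 1)}"
    using i by (auto simp: block_Suc v_eq_iff)
  moreover have "(R_mono K {v (2 * i + 1)} {v (2 * i)} :: _ \<Rightarrow> 'k) \<in> factor i"
    unfolding cohom_class_def R_algebra_def dga.simps mem_Collect_eq
    by (rule exI[of _ 0]) (simp add: R_diff_zero R_carrier_def)
  ultimately show "(if i < i + 1 then R_mono K (block i (i + 1) - {v (2 * i)}) {v (2 * i)} else 0 :: _ \<Rightarrow> 'k) \<in> factor i"
    by simp
next
  show "(diagonal :: _ \<Rightarrow> 'k) \<in> R_carrier K" by (simp add: R_carrier_def R_mono_def)
next
  fix i j assume ij: "i \<in> {1..k+1}" "j \<in> {1..k+1}"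
  show "(if i = 1 \<and> j = k + 1 then diagonal else 0 :: _ \<Rightarrow> 'k) =
      R_diff e K (if i < j then R_mono K (block i j - {v (2 * i)}) {v (2 * i)} else 0) +
      (\<Sum>l\<in>{i<..<j}. R_mult e K (if i < l then R_mono K (block i l - {v (2 * i)}) {v (2 * i)} else 0)
        (if l < j then R_mono K (block l j - {v (2 * l)}) {v (2 * l)} else 0))"
  proof (cases "i < j")
    case True
    have products: "(\<Sum>l\<in>{i<..<j}. R_mult e K (if i < l then R_mono K (block i l - {v (2 * i)}) {v (2 * i)} else 0)
        (if l < j then R_mono K (block l j - {v (2 * l)}) {v (2 * l)} else 0)) =
        (\<Sum>l\<in>{i<..<j}. R_mono K (block i j - {v (2 * i), v (2 * l)}) {v (2 * i), v (2 * l)} :: _ \<Rightarrow> 'k)"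
      using ij by (intro sum.cong refl) (simp add: mult_standard)
    have "1 \<le> i" "j \<le> k + 1" using ij by auto
    note diff = diff_standard[OF this(1) True this(2)]
    show ?thesis unfolding products using True by (simp only: if_True diff diff_add_cancel)
  next
    case False
    then have "{i<..<j} = {}" "\<not> (i = 1 \<and> j = k + 1)" using two_le by simp_all
    then show ?thesis using False by (simp only: if_False sum.empty R_diff_zero add_0_left)
  qed
qed auto

text \<open>The sign turns the differential into the coboundary of functions on vertices.\<close>

definition twisted ::
  "(nat \<Rightarrow> nat \<Rightarrow> 'v set \<times> 'v set \<Rightarrow> 'k::comm_ring_1) \<Rightarrow> nat \<Rightarrow> nat \<Rightarrow> nat \<Rightarrow> 'k" where
  "twisted c i j t = (-1) ^ t * coef (c i j) i j t"

section \<open>Arbitrary defining systems, evaluated on edges\<close>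

lemma diff_coef_twisted:
  fixes x :: "'v set \<times> 'v set \<Rightarrow> 'k::comm_ring_1"
  assumes "1 \<le> i" "j \<le> k + 1" "2 * i \<le> s" "s < t" "t < 2 * j" "{v s, v t} \<in> K"
  shows "R_diff e K x (block i j - {v s, v t}, {v s, v t}) =
    (-1) ^ s * (-1) ^ t * ((-1) ^ t * coef x i j t - (-1) ^ s * coef x i j s)"
  unfolding diff_coef[OF assms] by (simp add: minus_one_power_iff)

text \<open>This turns the Maurer-Cartan equation on an edge into the flatness condition of
  \<open>holonomy\<close>. The cuts with \<open>s < 2 * l\<close> and \<open>2 * l <= t\<close>
  found in \<open>mult_coef\<close> form the range of \<open>transport\<close>.\<close>

lemma curvature:
  fixes c :: "nat \<Rightarrow> nat \<Rightarrow> 'v set \<times> 'v set \<Rightarrow> 'k::comm_ring_1"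
  assumes comp: "\<And>i j. 1 \<le> i \<Longrightarrow> i < j \<Longrightarrow> j \<le> k + 1 \<Longrightarrow>
      c i j \<in> R_comp K (entry_degree (\<lambda>_. 3) i j) (\<Sum>l\<in>{i..<j}. weight l)"
    and ij: "1 \<le> i" "j \<le> k + 1" and st: "2 * i \<le> s" "s < t" "t < 2 * j" and K: "{v s, v t} \<in> K"
  shows "(R_diff e K (c i j) + (\<Sum>l\<in>{i<..<j}. R_mult e K (c i l) (c l j)))
      (block i j - {v s, v t}, {v s, v t}) =
    (-1) ^ s * (-1) ^ t *
      (twisted c i j t - twisted c i j s + transport (twisted c) i j s t)"
proof -
  have "(\<Sum>l\<in>{i<..<j}. R_mult e K (c i l) (c l j)) (block i j - {v s, v t}, {v s, v t}) =
      (\<Sum>l\<in>{i<..<j}. if s < 2 * l \<and> 2 * l \<le> t then coef (c i l) i l s * coef (c l j) l j t else 0)"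
    unfolding sum_apply using comp ij st K by (intro sum.cong refl mult_coef) auto
  also have "\<dots> = (\<Sum>l\<in>{l \<in> {i<..<j}. s < 2 * l \<and> 2 * l \<le> t}.
      coef (c i l) i l s * coef (c l j) l j t)"
    by (rule sum.inter_filter[symmetric]) simp
  also have "{l \<in> {i<..<j}. s < 2 * l \<and> 2 * l \<le> t} = {s div 2<..t div 2}"
    using st by auto
  also have "(\<Sum>l\<in>{s div 2<..t div 2}. coef (c i l) i l s * coef (c l j) l j t) =
      (-1) ^ s * (-1) ^ t * transport (twisted c) i j s t"
    unfolding transport_def sum_distrib_left
    by (intro sum.cong refl) (simp add: minus_one_power_iff twisted_def)
  finally show ?thesis
    using diff_coef_twisted[OF ij st K, of "c i j"] by (simp add: distrib_left twisted_def)
qed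

text \<open>A coboundary changes the two coefficients on the pair by opposite amounts, both coming
  from the product of the two exterior generators. Their sum stays 1; after twisting this is the
  unit jump required by \<open>holonomy\<close>.\<close>

lemma factor_coef:
  fixes x :: "'v set \<times> 'v set \<Rightarrow> 'k::comm_ring_1"
  assumes i: "1 \<le> i" "i \<le> k" and x: "x \<in> factor i"
  shows "coef x i (i + 1) (2 * i) = - coef x i (i + 1) (2 * i + 1) + 1"
proof -
  obtain y where y: "x = R_mono K {v (2 * i + 1)} {v (2 * i)} + R_diff e K y"
    using x by (auto simp: cohom_class_def R_algebra_def)
  have ne: "v (2 * i) \<noteq> v (2 * i + 1)" using i by (simp add: v_eq_iff)
  have basis: "({v (2 * i + 1)}, {v (2 * i)}) \<in> R_basis K" "({v (2 * i)}, {v (2 * i + 1)}) \<in> R_basis K"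
    using i vertex[of "2 * i"] vertex[of "2 * i + 1"] ne by (auto simp: R_basis_def)
  have o: "e (v (2 * i)) < e (v (2 * i + 1))" using order[of "2 * i" "2 * i + 1"] i by simp
  have block: "block i (i + 1) - {v (2 * i)} = {v (2 * i + 1)}"
    "block i (i + 1) - {v (2 * i + 1)} = {v (2 * i)}"
    unfolding block_Suc using ne by auto
  have before: "{p. p = v (Suc (2 * i)) \<and> e p < e (v (2 * i))} = {}"
    "{p. p = v (2 * i) \<and> e p < e (v (Suc (2 * i)))} = {v (2 * i)}"
    using o by auto
  have "R_diff e K y ({v (2 * i + 1)}, {v (2 * i)}) = y ({v (2 * i), v (2 * i + 1)}, {})"
    using basis(1) by (simp add: R_diff_def before(1))
  moreover have "R_diff e K y ({v (2 * i)}, {v (2 * i + 1)}) = - y ({v (2 * i), v (2 * i + 1)}, {})"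
    using basis(2) by (simp add: R_diff_def before(2) insert_commute)
  ultimately show ?thesis
    unfolding block y using basis ne by (simp add: R_mono_def)
qed

text \<open>\<open>holonomy\<close> supplies \<open>h\<close> for the twisted entries. Subtracting
  the coboundary of \<open>F - h\<close> replaces the last entry, which is arbitrary, by
  \<open>h\<close>, and then only the exceptional edge survives.\<close>

lemma defining_system_class:
  fixes a :: "'v set \<times> 'v set \<Rightarrow> 'k::comm_ring_1"
  assumes "defining_system (R_algebra e K) k (\<lambda>_. 3) weight factor c a"
  shows "cohom_class (R_algebra e K) a = cohom_class (R_algebra e K) diagonal"
proof -
  note sys = assms[unfolded system_iff]
  define f where "f = twisted c"
  define deg where "deg i j = entry_degree (\<lambda>_. 3) i j" for i j
  define w where "w i j = (\<Sum>l\<in>{i..<j}. weight l)" for i j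
  have comp: "c i j \<in> R_comp K (deg i j) (w i j)" if "1 \<le> i" "i < j" "j \<le> k + 1" for i j
    using sys that unfolding deg_def w_def by simp
  have MC: "(if i = 1 \<and> j = k + 1 then a else 0) =
      R_diff e K (c i j) + (\<Sum>l\<in>{i<..<j}. R_mult e K (c i l) (c l j))"
    if "1 \<le> i" "j \<le> k + 1" "i < j" for i j
    using sys that by simp
  note curv = curvature[of c, folded f_def, OF comp[unfolded deg_def w_def]]
  have "f i j t - f i j s + transport f i j s t = 0"
    if "1 \<le> i" "i < j" "j \<le> k + 1" "(i, j) \<noteq> (1, k + 1)" "2 * i \<le> s" "s < t" "t < 2 * j"
      "odd s \<or> even t" for i j s t
  proof -
    have K: "{v s, v t} \<in> K" using edge[of s t] that by auto
    have "(R_diff e K (c i j) + (\<Sum>l\<in>{i<..<j}. R_mult e K (c i l) (c l j)))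
        (block i j - {v s, v t}, {v s, v t}) = 0"
      using MC[of i j] that by (metis (no_types, lifting) zero_fun_apply)
    then have "(-1) ^ s * (-1) ^ t * (f i j t - f i j s + transport f i j s t) = 0"
      using curv[of i j s t] that K by simp
    then show ?thesis by (simp only: signs_cancel)
  qed
  moreover have "f i (i + 1) (2 * i) = f i (i + 1) (2 * i + 1) + 1" if "1 \<le> i" "i \<le> k" for i
    using factor_coef[OF that, of "c i (i + 1)"] sys that by (simp add: f_def twisted_def)
  ultimately obtain h where h: "\<And>s t. 2 \<le> s \<Longrightarrow> s < t \<Longrightarrow> t \<le> 2 * k + 1 \<Longrightarrow> odd s \<or> even t \<Longrightarrow>
      h t - h s + transport f 1 (k + 1) s t = 0"
    and h_jump: "h (2 * k + 1) - h 2 + transport f 1 (k + 1) 2 (2 * k + 1) = - 1"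
    using holonomy[OF two_le, of f] by blast
  define F where "F = f 1 (k + 1)"
  \<comment> \<open>The factor \<open>(-1) ^ t\<close> undoes the twist, so that \<open>y\<close>
    has the twisted values \<open>F t - h t\<close>.\<close>
  define y where "y = (\<Sum>t\<in>{2..2 * k + 1}. (\<lambda>p. (-1) ^ t * (F t - h t) *
      R_mono K (block 1 (k + 1) - {v t}) {v t} p))"
  have y_coef: "(-1) ^ t * coef y 1 (k + 1) t = F t - h t" if t: "t \<in> {2..2 * k + 1}" for t
  proof -
    have "R_mono K (block 1 (k + 1) - {v u}) {v u} (block 1 (k + 1) - {v t}, {v t}) =
        (if u = t then 1 else 0 :: 'k)" if u: "u \<in> {2..2 * k + 1}" for u
      using block_subset[of 1 "k + 1"] vertex[of t] t u
      by (auto simp: R_mono_def R_basis_def v_eq_iff)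
    then have "coef y 1 (k + 1) t = (\<Sum>u\<in>{2..2 * k + 1}. if u = t then (-1) ^ u * (F u - h u) else 0)"
      unfolding y_def sum_apply by (intro sum.cong refl) simp
    then show ?thesis using t by (simp add: minus_one_power_iff)
  qed
  have degree: "deg i j = 2 * int (j - i) + 1" if "i < j" for i j
    using that by (simp add: deg_def entry_degree_const)
  have y: "y \<in> R_comp K (deg 1 (k + 1)) (w 1 (k + 1))"
    unfolding y_def
  proof (rule R_comp_sum)
    fix t assume t: "t \<in> {2..2 * k + 1}"
    then have vt: "v t \<in> block 1 (k + 1)" by auto
    have "R_mono K (block 1 (k + 1) - {v t}) {v t} \<in> (R_comp K (deg 1 (k + 1)) (w 1 (k + 1)) :: (_ \<Rightarrow> 'k) set)"
    proof (rule R_mono_in_comp)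
      show "deg 1 (k + 1) = int (card (block 1 (k + 1) - {v t}) + 2 * card {v t})"
        using vt card_block[of 1 "k + 1"] two_le by (simp add: degree card_Diff_singleton of_nat_diff)
      have "block 1 (k + 1) - {v t} \<union> {v t} = block 1 (k + 1)" using vt by blast
      then show "w 1 (k + 1) = (\<lambda>x. if x \<in> block 1 (k + 1) - {v t} \<union> {v t} then 1 else 0)"
        unfolding w_def using sum_weight[of 1 "k + 1"] by (simp only:)
    qed
    then show "(\<lambda>p. (-1) ^ t * (F t - h t) * R_mono K (block 1 (k + 1) - {v t}) {v t} p) \<in>
        R_comp K (deg 1 (k + 1)) (w 1 (k + 1))"
      by (rule R_comp_scale)
  qed
  have a: "a = R_diff e K (c 1 (k + 1)) + (\<Sum>l\<in>{1<..<k + 1}. R_mult e K (c 1 l) (c l (k + 1)))"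
    using MC[of 1 "k + 1"] two_le by simp
  have top: "deg 1 (k + 1) + 1 = 2 * int k + 2"
    using degree[of 1 "k + 1"] two_le by simp
  have "R_mult e K (c 1 l) (c l (k + 1)) \<in> R_comp K (2 * int k + 2) (w 1 (k + 1))"
    if l: "l \<in> {1<..<k + 1}" for l
  proof -
    have "deg 1 l + deg l (k + 1) = 2 * int k + 2" using degree[of 1 l] degree[of l "k + 1"] l
      by (simp add: of_nat_diff)
    moreover have "w 1 l + w l (k + 1) = w 1 (k + 1)"
      unfolding w_def using l by (intro sum.atLeastLessThan_concat) auto
    ultimately show ?thesis
      using R_mult_in_comp[OF comp comp fin, of 1 l l "k + 1" e] l by simp
  qed
  \<comment> \<open>By homogeneity the difference has exactly two polynomial factors, so it suffices
    to compare coefficients on edges.\<close>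
  then have "a - diagonal - R_diff e K y \<in> R_comp K (2 * int k + 2) (w 1 (k + 1))"
    unfolding a diff_conv_add_uminus
    using R_diff_in_comp[OF y fin, of e] R_diff_in_comp[OF comp[of 1 "k + 1"] fin, of e]
      diagonal_in_comp[folded w_def] two_le
    unfolding top by (intro R_comp_add R_comp_minus R_comp_sum) auto
  note support = support_union[OF this[unfolded w_def]]
  have "(a - diagonal - R_diff e K y) (J, I) = 0" for J I
  proof (rule ccontr)
    assume nz: "(a - diagonal - R_diff e K y) (J, I) \<noteq> 0"
    note S = support[OF _ _ _ nz]
    have "card I = 2" using S(3) by simp
    then obtain p q where pq: "I = {p, q}" "p \<noteq> q" by (auto simp: card_2_iff)
    have "block 1 (k + 1) = v ` {2..2 * k + 1}" by (rule arg_cong[where f = "image v"]) auto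
    then have "p \<in> v ` {2..2 * k + 1}" "q \<in> v ` {2..2 * k + 1}" using S(2) pq by simp_all
    then obtain s' t' where "s' \<in> {2..2 * k + 1}" "t' \<in> {2..2 * k + 1}" "p = v s'" "q = v t'"
      by blast
    then obtain s t where st: "2 \<le> s" "s < t" "t \<le> 2 * k + 1" "I = {v s, v t}"
      using pq by (metis atLeastAtMost_iff insert_commute linorder_neqE_nat)
    then have K: "{v s, v t} \<in> K" and J: "J = block 1 (k + 1) - {v s, v t}" using S(1,4) by simp_all
    have mem: "s \<in> {2..2 * k + 1}" "t \<in> {2..2 * k + 1}" using st by auto
    have "a (J, I) = (-1) ^ s * (-1) ^ t * (F t - F s + transport f 1 (k + 1) s t)"
      unfolding a J st(4) F_def by (rule curv) (use st K in auto)
    moreover have "R_diff e K y (J, I) = (-1) ^ s * (-1) ^ t *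
        ((-1) ^ t * coef y 1 (k + 1) t - (-1) ^ s * coef y 1 (k + 1) s)"
      unfolding J st(4) by (rule diff_coef_twisted) (use st K in auto)
    ultimately have diff: "a (J, I) - R_diff e K y (J, I) =
        (-1) ^ s * (-1) ^ t * (h t - h s + transport f 1 (k + 1) s t)"
      by (simp only: y_coef[OF mem(1)] y_coef[OF mem(2)]) (simp add: algebra_simps)
    \<comment> \<open>On the exceptional edge the sign \<open>(-1) ^ s * (-1) ^ t\<close> and the
      jump of \<open>h\<close> are both -1, which gives the coefficient 1 of the diagonal.\<close>
    have "a (J, I) - R_diff e K y (J, I) = (if s = 2 \<and> t = 2 * k + 1 then 1 else 0)"
    proof (cases "s = 2 \<and> t = 2 * k + 1")
      case True
      then show ?thesis unfolding diff using h_jump by simp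
    next
      case False
      then have "odd s \<or> even t" using edge[OF st(1-3)] K by blast
      then show ?thesis unfolding diff using h[OF st(1-3)] False by simp
    qed
    moreover have "diagonal (J, I) = (if s = 2 \<and> t = 2 * k + 1 then 1 else 0 :: 'k)"
      unfolding J st(4) by (rule diagonal_coef[OF st(1-3) K])
    moreover have "(a - diagonal - R_diff e K y) (J, I) = a (J, I) - R_diff e K y (J, I) - diagonal (J, I)"
      by simp
    ultimately show False using nz by (simp only: diff_self)
  qed
  then have "a - diagonal - R_diff e K y = 0"
    by (intro ext) (metis surj_pair zero_fun_apply)
  then have "a = diagonal + R_diff e K y"
    by (metis add.commute add_0 diff_add_cancel)
  moreover have "y \<in> R_carrier K" using y by (simp add: R_comp_def)
  ultimately show ?thesis by (rule R_class_cong)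
qed

theorem massey_product_eq:
  "massey_product (R_algebra e K) k (\<lambda>_. 3) weight factor =
    {cohom_class (R_algebra e K) (diagonal :: 'v set \<times> 'v set \<Rightarrow> 'k::comm_ring_1)}"
  unfolding massey_product_def using standard_system defining_system_class by blast

text \<open>A coboundary sums to zero over the cycle \<open>v 2, v (2 * k), v 3, v (2 * k + 1)\<close>, of whose edges
  the diagonal meets only the last one.\<close>

lemma diagonal_nontrivial:
  "cohom_class (R_algebra e K) 0 \<noteq>
    cohom_class (R_algebra e K) (diagonal :: 'v set \<times> 'v set \<Rightarrow> 'k::comm_ring_1)"
proof
  assume eq: "cohom_class (R_algebra e K) 0 =
    cohom_class (R_algebra e K) (diagonal :: 'v set \<times> 'v set \<Rightarrow> 'k)"
  have "(diagonal :: _ \<Rightarrow> 'k) \<in> cohom_class (R_algebra e K) diagonal"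
    unfolding cohom_class_def R_algebra_def dga.simps mem_Collect_eq
    by (rule exI[of _ 0]) (simp add: R_diff_zero R_carrier_def)
  then obtain y where y: "diagonal = R_diff e K (y :: _ \<Rightarrow> 'k)"
    unfolding eq[symmetric] by (auto simp: cohom_class_def R_algebra_def)
  define g where "g t = (-1) ^ t * coef y 1 (k + 1) t" for t
  have "(-1) ^ s * (-1) ^ t * (g t - g s) = (if s = 2 \<and> t = 2 * k + 1 then 1 else 0)"
    if "2 \<le> s" "s < t" "t \<le> 2 * k + 1" "odd s \<or> even t \<or> (s = 2 \<and> t = 2 * k + 1)" for s t
  proof -
    have K: "{v s, v t} \<in> K" using edge[of s t] that by simp
    have "R_diff e K y (block 1 (k + 1) - {v s, v t}, {v s, v t}) = (if s = 2 \<and> t = 2 * k + 1 then 1 else 0)"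
      unfolding y[symmetric] by (rule diagonal_coef[OF that(1-3) K])
    moreover have "R_diff e K y (block 1 (k + 1) - {v s, v t}, {v s, v t}) =
        (-1) ^ s * (-1) ^ t * (g t - g s)"
      unfolding g_def by (rule diff_coef_twisted) (use that K in auto)
    ultimately show ?thesis by (rule trans[OF sym, rotated])
  qed
  from this[of 2 "2 * k"] this[of 3 "2 * k"] this[of 3 "2 * k + 1"] this[of 2 "2 * k + 1"]
  show False using two_le by simp
qed

end

section \<open>Nested sets\<close>

text \<open>All powers of 2 with exponent below \<open>y\<close> together stay under
  \<open>2 ^ y\<close>, so \<open>y\<close> alone outweighs whatever \<open>X\<close> has and
  \<open>Y\<close> lacks.\<close>

lemma set_encode_less:
  assumes fin: "finite X" "finite Y" and y: "y \<in> Y" "y \<notin> X" and below: "\<And>x. x \<in> X \<Longrightarrow> x \<notin> Y \<Longrightarrow> x < y"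
  shows "set_encode X < set_encode Y"
proof -
  have "set_encode (X - Y) \<le> set_encode {..<y}"
    unfolding set_encode_def by (rule sum_mono2) (use below in auto)
  also have "\<dots> < 2 ^ y"
    by (simp add: set_encode_def lessThan_atLeast0 sum_power2)
  also have "\<dots> = set_encode {y}" by (simp add: set_encode_def)
  also have "\<dots> \<le> set_encode (Y - X)"
    unfolding set_encode_def by (rule sum_mono2) (use y fin in auto)
  finally have "set_encode (X - Y) < set_encode (Y - X)" .
  moreover have "set_encode X = set_encode (X \<inter> Y) + set_encode (X - Y)"
    unfolding set_encode_def using fin by (subst sum.union_disjoint[symmetric]) (auto intro: sum.cong)
  moreover have "set_encode Y = set_encode (X \<inter> Y) + set_encode (Y - X)"
    unfolding set_encode_def using fin by (subst sum.union_disjoint[symmetric]) (auto intro: sum.cong)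
  ultimately show ?thesis by simp
qed

text \<open>The larger code belongs to the set containing the maximum of the symmetric difference,
  and an increasing map carries this maximum along.\<close>

lemma set_encode_less_image:
  assumes less: "set_encode X < set_encode Y" and fin: "finite X" "finite Y"
    and mono: "strict_mono_on A \<phi>" and sub: "X \<subseteq> A" "Y \<subseteq> A"
  shows "set_encode (\<phi> ` X) < set_encode (\<phi> ` Y)"
proof -
  have inj: "inj_on \<phi> A" using mono by (rule strict_mono_on_imp_inj_on)
  define D where "D = (X - Y) \<union> (Y - X)"
  have "D \<noteq> {}" using less by (auto simp: D_def)
  moreover have "finite D" using fin by (simp add: D_def)
  ultimately have m: "Max D \<in> D" "\<And>x. x \<in> D \<Longrightarrow> x \<le> Max D" by simp_all
  have lt: "x < Max D" if "x \<in> D" "x \<noteq> Max D" for x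
    using m(2)[OF that(1)] that(2) by simp
  have "Max D \<in> Y - X"
  proof (rule ccontr)
    assume "Max D \<notin> Y - X"
    then have "Max D \<in> X" "Max D \<notin> Y" using m(1) by (auto simp: D_def)
    then have "set_encode Y < set_encode X"
      using fin lt by (intro set_encode_less[of _ _ "Max D"]) (auto simp: D_def)
    then show False using less by simp
  qed
  then have M: "Max D \<in> Y" "Max D \<notin> X" by simp_all
  then have A: "Max D \<in> A" using sub by blast
  show ?thesis
  proof (rule set_encode_less[of _ _ "\<phi> (Max D)"])
    show "\<phi> (Max D) \<in> \<phi> ` Y" "\<phi> (Max D) \<notin> \<phi> ` X"
      using M by (simp_all add: inj_on_image_mem_iff[OF inj A] sub)
    fix z assume "z \<in> \<phi> ` X" "z \<notin> \<phi> ` Y"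
    then obtain x where x: "z = \<phi> x" "x \<in> X" "x \<notin> Y" by blast
    then have "x < Max D" using M lt[of x] by (auto simp: D_def)
    then show "z < \<phi> (Max D)" using strict_mono_onD[OF mono _ A] x sub by blast
  qed (use fin in simp_all)
qed

text \<open>The elements 1, 2 and \<open>n + 1\<close> are the distinguished ones of
  \<open>mas_building_set n\<close>. For \<open>2 <= r\<close> and \<open>r <= s\<close> this
  increasing map respects all three, since it sends the top element to the top element.\<close>

definition reindex :: "nat \<Rightarrow> nat \<Rightarrow> nat \<Rightarrow> nat" where
  "reindex r s i = (if i \<le> r then i else s + 1)"

lemma reindex_strict_mono: "r \<le> s \<Longrightarrow> strict_mono_on {1..r + 1} (reindex r s)"
  by (rule strict_mono_onI) (auto simp: reindex_def)

lemma reindex_inj: "r \<le> s \<Longrightarrow> inj_on (reindex r s) {1..r + 1}"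
  using reindex_strict_mono by (rule strict_mono_on_imp_inj_on)

lemma reindex_range: "r \<le> s \<Longrightarrow> reindex r s ` {1..r + 1} \<subseteq> {1..s + 1}"
  by (auto simp: reindex_def)

lemma reindex_image_mem_iff:
  assumes "r \<le> s" "S \<subseteq> {1..r + 1}" "i \<le> r"
  shows "i \<in> reindex r s ` S \<longleftrightarrow> i \<in> S"
  using assms by (auto simp: reindex_def image_iff split: if_splits)

lemma reindex_image_top:
  assumes "r \<le> s" "S \<subseteq> {1..r + 1}"
  shows "s + 1 \<in> reindex r s ` S \<longleftrightarrow> r + 1 \<in> S"
proof
  assume "s + 1 \<in> reindex r s ` S"
  then obtain i where i: "i \<in> S" "s + 1 = reindex r s i" by blast
  then have "i = r + 1" using assms by (cases "i \<le> r") (auto simp: reindex_def)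
  then show "r + 1 \<in> S" using i by simp
next
  assume "r + 1 \<in> S"
  then have "reindex r s (r + 1) \<in> reindex r s ` S" by (rule imageI)
  then show "s + 1 \<in> reindex r s ` S" by (simp add: reindex_def)
qed

lemma mas_subset: "S \<in> mas_building_set n \<Longrightarrow> 2 \<le> n \<Longrightarrow> S \<noteq> {} \<and> S \<subseteq> {1..n + 1}"
  using connected_building_set_mas[of n] unfolding connected_building_set_def building_set_def by blast

text \<open>In this form membership depends only on being a singleton and on containing 1, 2 and
  \<open>n + 1\<close>; \<open>reindex\<close> preserves and reflects each of these
  properties.\<close>

lemma mas_iff:
  assumes n: "2 \<le> n" and S: "S \<subseteq> {1..n + 1}"
  shows "S \<in> mas_building_set n \<longleftrightarrow>
    is_singleton S \<or> 1 \<in> S \<and> (2 \<in> S \<or> n + 1 \<notin> S)"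
proof -
  have "S \<subseteq> {1, 2} \<union> {3..n + 1}"
  proof
    fix x assume "x \<in> S"
    then have "1 \<le> x" "x \<le> n + 1" using S by auto
    then show "x \<in> {1, 2} \<union> {3..n + 1}" by auto
  qed
  moreover have "S \<subseteq> {1} \<union> {3..n} \<longleftrightarrow> n + 1 \<notin> S" if "2 \<notin> S"
  proof
    assume "S \<subseteq> {1} \<union> {3..n}"
    then show "n + 1 \<notin> S" using n by auto
  next
    assume "n + 1 \<notin> S"
    show "S \<subseteq> {1} \<union> {3..n}"
    proof
      fix x assume "x \<in> S"
      then have "1 \<le> x" "x \<le> n + 1" "x \<noteq> n + 1" "x \<noteq> 2" using S that \<open>n + 1 \<notin> S\<close> by auto
      then show "x \<in> {1} \<union> {3..n}" by auto
    qed
  qed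
  moreover have "(\<exists>i\<in>{1..n + 1}. S = {i}) \<longleftrightarrow> is_singleton S"
    using S by (auto simp: is_singleton_def)
  moreover have "S = {1} \<Longrightarrow> is_singleton S" by (simp add: is_singleton_def)
  ultimately show ?thesis unfolding mas_building_set_iff by blast
qed

lemma reindex_mas_iff:
  assumes r: "2 \<le> r" "r \<le> s" and S: "S \<subseteq> {1..r + 1}"
  shows "reindex r s ` S \<in> mas_building_set s \<longleftrightarrow> S \<in> mas_building_set r"
proof -
  have "reindex r s ` S \<subseteq> {1..s + 1}" using reindex_range[OF r(2)] S by blast
  moreover have "is_singleton (reindex r s ` S) \<longleftrightarrow> is_singleton S"
    using card_image[OF inj_on_subset[OF reindex_inj[OF r(2)] S]] by (simp add: is_singleton_altdef)
  moreover have "1 \<in> reindex r s ` S \<longleftrightarrow> 1 \<in> S" "2 \<in> reindex r s ` S \<longleftrightarrow> 2 \<in> S"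
    using reindex_image_mem_iff[OF r(2) S] r(1) by simp_all
  ultimately show ?thesis
    using mas_iff[of s] mas_iff[OF r(1) S] reindex_image_top[OF r(2) S] r by simp
qed

section \<open>Nested set complexes and their embeddings\<close>

lemma N_mas_vertices: "\<Union>(N_mas n) \<subseteq> nested_vertices n (mas_building_set n)"
  by (auto simp: nested_complex_def)

lemma nested_vertex_subset: "2 \<le> n \<Longrightarrow> S \<in> nested_vertices n (mas_building_set n) \<Longrightarrow> S \<noteq> {} \<and> S \<subseteq> {1..n + 1}"
  using mas_subset[of S n] by (simp add: nested_vertices_def)

lemma N_mas_vertex_subset: "2 \<le> n \<Longrightarrow> S \<in> \<Union>(N_mas n) \<Longrightarrow> S \<subseteq> {1..n + 1}"
  using N_mas_vertices nested_vertex_subset by blast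

lemma finite_N_mas_vertices: "2 \<le> n \<Longrightarrow> finite (\<Union>(N_mas n))"
  by (rule finite_subset[of _ "Pow {1..n + 1}"]) (use N_mas_vertex_subset in auto)

lemma nested_complex_down: "\<sigma> \<in> nested_complex n B \<Longrightarrow> \<tau> \<subseteq> \<sigma> \<Longrightarrow> \<tau> \<in> nested_complex n B"
  unfolding nested_complex_def by (simp add: subset_iff)

lemma nested_complex_vertex:
  assumes "S \<in> nested_vertices n B"
  shows "{S} \<in> nested_complex n B"
proof -
  have "\<not> 2 \<le> card \<tau>" if "\<tau> \<subseteq> {S}" for \<tau> using card_mono[OF _ that] by simp
  then show ?thesis using assms unfolding nested_complex_def by blast
qed

lemma nested_complex_edge_iff:
  assumes S: "S \<in> nested_vertices n B" and T: "T \<in> nested_vertices n B" and ne: "S \<noteq> T"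
  shows "{S, T} \<in> nested_complex n B \<longleftrightarrow>
    (S \<inter> T = {} \<or> S \<subseteq> T \<or> T \<subseteq> S) \<and> (S \<inter> T = {} \<longrightarrow> S \<union> T \<notin> B)"
proof -
  have "\<tau> = {S, T}" if "\<tau> \<subseteq> {S, T}" "card \<tau> \<ge> 2" for \<tau>
    by (rule card_seteq) (use that ne in auto)
  then have "(\<forall>\<tau>\<subseteq>{S, T}. card \<tau> \<ge> 2 \<longrightarrow> pairwise disjnt \<tau> \<longrightarrow> \<Union>\<tau> \<notin> B) \<longleftrightarrow>
      (pairwise disjnt {S, T} \<longrightarrow> \<Union>{S, T} \<notin> B)"
    using ne by (metis card_2_iff order_refl)
  moreover have "pairwise disjnt {S, T} \<longleftrightarrow> S \<inter> T = {}"
    using ne by (auto simp: pairwise_def disjnt_def)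
  ultimately show ?thesis using S T by (auto simp: nested_complex_def)
qed

lemma reindex_vertex:
  assumes r: "2 \<le> r" "r \<le> s" and S: "S \<in> nested_vertices r (mas_building_set r)"
  shows "reindex r s ` S \<in> nested_vertices s (mas_building_set s)"
proof -
  have sub: "S \<subseteq> {1..r + 1}" and mem: "S \<in> mas_building_set r" "S \<noteq> {1..r + 1}"
    using nested_vertex_subset[OF r(1) S] S by (simp_all add: nested_vertices_def)
  \<comment> \<open>The image is not the whole ground set because it has fewer than
    \<open>r + 1\<close> elements, hence fewer than \<open>s + 1\<close>.\<close>
  have "card (reindex r s ` S) = card S"
    by (rule card_image[OF inj_on_subset[OF reindex_inj[OF r(2)] sub]])
  also have "\<dots> < card {1..r + 1}" by (rule psubset_card_mono) (use sub mem in auto)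
  finally have "reindex r s ` S \<noteq> {1..s + 1}" using r by auto
  then show ?thesis using reindex_mas_iff[OF r sub] mem by (simp add: nested_vertices_def)
qed

lemma inj_on_image_vertices:
  assumes "2 \<le> r" "r \<le> s"
  shows "inj_on (image (reindex r s)) (\<Union>(N_mas r))"
proof (rule inj_onI)
  fix S T assume "S \<in> \<Union>(N_mas r)" "T \<in> \<Union>(N_mas r)" "reindex r s ` S = reindex r s ` T"
  then show "S = T"
    using inj_on_image_eq_iff[OF reindex_inj[OF assms(2)]] N_mas_vertex_subset[OF assms(1)] by blast
qed

text \<open>Images under an injective map keep inclusions and disjointness. They also commute with
  unions, so \<open>reindex_mas_iff\<close> turns a forbidden union in the target into one in the
  source.\<close>

lemma reindex_embedding:
  assumes r: "2 \<le> r" "r \<le> s"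
  shows "simplicial_embedding (image (reindex r s)) (N_mas r) (N_mas s)"
  unfolding simplicial_embedding_def
proof (intro conjI ballI inj_on_image_vertices[OF r])
  fix \<sigma> assume \<sigma>: "\<sigma> \<in> N_mas r"
  let ?j = "image (reindex r s)"
  have vert: "\<sigma> \<subseteq> nested_vertices r (mas_building_set r)"
    and nested: "\<And>S T. S \<in> \<sigma> \<Longrightarrow> T \<in> \<sigma> \<Longrightarrow> S \<inter> T = {} \<or> S \<subseteq> T \<or> T \<subseteq> S"
    and free: "\<And>\<tau>. \<tau> \<subseteq> \<sigma> \<Longrightarrow> card \<tau> \<ge> 2 \<Longrightarrow> pairwise disjnt \<tau> \<Longrightarrow> \<Union>\<tau> \<notin> mas_building_set r"
    using \<sigma> unfolding nested_complex_def by blast+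
  have sub: "S \<subseteq> {1..r + 1}" if "S \<in> \<sigma>" for S
    using vert nested_vertex_subset[OF r(1)] that by blast
  have Int: "?j S \<inter> ?j T = ?j (S \<inter> T)" if "S \<in> \<sigma>" "T \<in> \<sigma>" for S T
    using inj_on_image_Int[OF reindex_inj[OF r(2)] sub sub] that by simp
  have "?j ` \<sigma> \<subseteq> nested_vertices s (mas_building_set s)"
    using vert reindex_vertex[OF r] by blast
  moreover have "A \<inter> B = {} \<or> A \<subseteq> B \<or> B \<subseteq> A" if AB: "A \<in> ?j ` \<sigma>" "B \<in> ?j ` \<sigma>" for A B
  proof -
    obtain S T where ST: "S \<in> \<sigma>" "T \<in> \<sigma>" "A = ?j S" "B = ?j T" using AB by blast
    then show ?thesis using nested[OF ST(1,2)] Int[OF ST(1,2)] by (auto intro: image_mono)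
  qed
  moreover have "\<Union>\<tau>' \<notin> mas_building_set s"
    if \<tau>': "\<tau>' \<subseteq> ?j ` \<sigma>" "card \<tau>' \<ge> 2" "pairwise disjnt \<tau>'" for \<tau>'
  proof -
    obtain \<tau> where \<tau>: "\<tau> \<subseteq> \<sigma>" "\<tau>' = ?j ` \<tau>" using \<tau>'(1) by (meson subset_imageE)
    have inj: "inj_on ?j \<tau>" by (rule inj_on_subset[OF inj_on_image_vertices[OF r]]) (use \<tau> \<sigma> in blast)
    have "pairwise disjnt \<tau>"
    proof (rule pairwiseI)
      fix S T assume ST: "S \<in> \<tau>" "T \<in> \<tau>" "S \<noteq> T"
      then have "?j S \<noteq> ?j T" using inj by (meson inj_on_eq_iff)
      then have "?j S \<inter> ?j T = {}" using \<tau>'(3) ST unfolding \<tau>(2) pairwise_def disjnt_def by blast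
      then show "disjnt S T" unfolding disjnt_def by blast
    qed
    moreover have "card \<tau> \<ge> 2" using \<tau>'(2) card_image[OF inj] \<tau>(2) by simp
    ultimately have "\<Union>\<tau> \<notin> mas_building_set r" using free \<tau>(1) by blast
    moreover have "\<Union>\<tau> \<subseteq> {1..r + 1}" using sub \<tau>(1) by blast
    moreover have "\<Union>\<tau>' = ?j (\<Union>\<tau>)" unfolding \<tau>(2) by blast
    ultimately show ?thesis using reindex_mas_iff[OF r] by simp
  qed
  ultimately show "?j ` \<sigma> \<in> N_mas s" unfolding nested_complex_def by blast
qed

lemma reindex_monotone_embedding:
  assumes r: "2 \<le> r" "r \<le> s"
  shows "monotone_embedding set_encode set_encode (N_mas r) (N_mas s) (image (reindex r s))"
proof
  show "simplicial_embedding (image (reindex r s)) (N_mas r) (N_mas s)" by (rule reindex_embedding[OF r])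
next
  fix S T assume S: "S \<in> \<Union>(N_mas r)" and T: "T \<in> \<Union>(N_mas r)"
  note sub = N_mas_vertex_subset[OF r(1) S] N_mas_vertex_subset[OF r(1) T]
  have fin: "finite S" "finite T" using sub finite_subset by blast+
  have *: "set_encode (reindex r s ` X) < set_encode (reindex r s ` Y)"
    if "set_encode X < set_encode Y" "finite X" "finite Y" "X \<subseteq> {1..r + 1}" "Y \<subseteq> {1..r + 1}" for X Y
    using that reindex_strict_mono[OF r(2)] by (intro set_encode_less_image[where A = "{1..r + 1}"]) auto
  \<comment> \<open>The converse follows from the forward implication with the sets exchanged, as
    distinct finite sets have distinct codes.\<close>
  show "set_encode S < set_encode T \<longleftrightarrow> set_encode (reindex r s ` S) < set_encode (reindex r s ` T)"
    using *[OF _ fin sub] *[OF _ fin(2,1) sub(2,1)] set_encode_eq[OF fin]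
    by (metis less_asym linorder_neqE_nat less_irrefl)
next
  fix \<sigma> \<tau> assume "\<sigma> \<in> N_mas r" "\<tau> \<subseteq> \<sigma>"
  then show "\<tau> \<in> N_mas r" by (rule nested_complex_down)
qed

text \<open>The reindexing of the singletons makes the \<open>k\<close> pairs in \<open>N_mas n\<close> the image of those in
  \<open>N_mas k\<close>; it affects only the last one.\<close>

definition mas_vertex :: "nat \<Rightarrow> nat \<Rightarrow> nat \<Rightarrow> nat set" where
  "mas_vertex k n t = (if even t then {1..t div 2} else {reindex k n (t div 2 + 1)})"

lemma mas_vertex_even: "mas_vertex k n (2 * i) = {1..i}"
  by (simp add: mas_vertex_def)

lemma mas_vertex_odd: "mas_vertex k n (2 * i + 1) = {reindex k n (i + 1)}"
  by (simp add: mas_vertex_def)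

lemma reindex_mas_vertex:
  assumes "k \<le> r" "r \<le> s" "t \<le> 2 * k + 1"
  shows "reindex r s ` mas_vertex k r t = mas_vertex k s t"
proof (cases "even t")
  case True
  then have "t div 2 \<le> r" using assms by auto
  then have "reindex r s ` {1..t div 2} = id ` {1..t div 2}"
    by (intro image_cong) (auto simp: reindex_def)
  then show ?thesis using True by (simp add: mas_vertex_def)
next
  case False
  then show ?thesis using assms by (simp add: mas_vertex_def reindex_def)
qed

lemma mas_vertex_in:
  assumes "2 \<le> k" "k \<le> n" "2 \<le> t" "t \<le> 2 * k + 1"
  shows "mas_vertex k n t \<in> nested_vertices n (mas_building_set n)"
proof (cases "even t")
  case True
  have "1 \<le> t div 2" "t div 2 \<le> n" using assms by auto
  then have S: "1 \<in> {1..t div 2}" "n + 1 \<notin> {1..t div 2}" "{1..t div 2} \<subseteq> {1..n + 1}" by auto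
  then have "{1..t div 2} \<noteq> {1..n + 1}" by force
  then show ?thesis using mas_iff[OF _ S(3)] S assms True
    by (simp add: nested_vertices_def mas_vertex_def)
next
  case False
  have S: "{reindex k n (t div 2 + 1)} \<subseteq> {1..n + 1}" using assms by (auto simp: reindex_def)
  have "card {reindex k n (t div 2 + 1)} \<noteq> card {1..n + 1}" using assms by simp
  then have "{reindex k n (t div 2 + 1)} \<noteq> {1..n + 1}" by metis
  then show ?thesis using mas_iff[OF _ S] assms False
    by (simp add: nested_vertices_def mas_vertex_def is_singleton_def)
qed

text \<open>The list runs \<open>{1}\<close>, \<open>{2}\<close>, \<open>{1,2}\<close>,
  \<open>{3}\<close>, \<open>{1,2,3}\<close> and so on. A singleton at an odd position exceeds every
  number in the preceding sets, and each interval has a larger code than the sets before it.\<close>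

lemma mas_vertex_less:
  assumes k: "2 \<le> k" "k \<le> n" and st: "2 \<le> s" "s < t" "t \<le> 2 * k + 1"
  shows "set_encode (mas_vertex k n s) < set_encode (mas_vertex k n t)"
proof (cases "even t")
  case False
  then obtain q where t: "t = 2 * q + 1" by (rule oddE)
  have lt: "x < reindex k n (q + 1)" if "x \<in> mas_vertex k n s" for x
    using that st k unfolding t mas_vertex_def
    by (cases "even s") (auto simp: reindex_def elim!: oddE)
  then have "reindex k n (q + 1) \<notin> mas_vertex k n s" by blast
  then show ?thesis
    unfolding t mas_vertex_odd using lt
    by (intro set_encode_less[of _ _ "reindex k n (q + 1)"]) (simp_all add: mas_vertex_def)
next
  case True
  then obtain q where t: "t = 2 * q" by (rule evenE)
  show ?thesis
  \<comment> \<open>Among the earlier sets only the direct predecessor \<open>{q}\<close> shares the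
    element \<open>q\<close> with \<open>{1..q}\<close>; there 1 decides the comparison, otherwise
    \<open>q\<close> does.\<close>
  proof (cases "s = 2 * q - 1")
    case True
    then have "s = 2 * (q - 1) + 1" "2 \<le> q" using st t by auto
    then have S: "mas_vertex k n s = {q}"
      using st t by (simp add: mas_vertex_def reindex_def)
    show ?thesis
      unfolding S t mas_vertex_even
      by (rule set_encode_less[of _ _ 1]) (use \<open>2 \<le> q\<close> in auto)
  next
    case False
    have "mas_vertex k n s \<subseteq> {1..<q}"
    proof (cases "even s")
      case True
      then show ?thesis using st t by (auto simp: mas_vertex_def elim!: evenE)
    next
      case False
      then obtain p where "s = 2 * p + 1" by (rule oddE)
      then show ?thesis using st t \<open>s \<noteq> 2 * q - 1\<close> by (auto simp: mas_vertex_def reindex_def)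
    qed
    then show ?thesis
      unfolding t mas_vertex_even using st t
      by (intro set_encode_less[of _ _ q]) (auto simp: mas_vertex_def)
  qed
qed

text \<open>For even \<open>t\<close> the two sets are nested. Two odd positions give disjoint
  singletons whose union lacks 1 and is not in the building set. An interval and a later singleton
  are disjoint, and their union is in the building set unless it contains \<open>n + 1\<close> but
  not 2.\<close>

lemma mas_vertex_edge:
  assumes k: "2 \<le> k" "k \<le> n" and st: "2 \<le> s" "s < t" "t \<le> 2 * k + 1"
  shows "{mas_vertex k n s, mas_vertex k n t} \<in> N_mas n \<longleftrightarrow>
    odd s \<or> even t \<or> (s = 2 \<and> t = 2 * k + 1)"
proof -
  define S T where "S = mas_vertex k n s" and "T = mas_vertex k n t"
  have "S \<noteq> T" using mas_vertex_less[OF assms] unfolding S_def T_def by (metis less_irrefl)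
  then have edge: "{S, T} \<in> N_mas n \<longleftrightarrow>
      (S \<inter> T = {} \<or> S \<subseteq> T \<or> T \<subseteq> S) \<and> (S \<inter> T = {} \<longrightarrow> S \<union> T \<notin> mas_building_set n)"
    unfolding S_def T_def using st by (intro nested_complex_edge_iff mas_vertex_in k) auto
  have sub: "S \<noteq> {}" "T \<noteq> {}" "S \<union> T \<subseteq> {1..n + 1}"
    using nested_vertex_subset[OF _ mas_vertex_in[OF k]] st k unfolding S_def T_def by auto
  have n: "2 \<le> n" using k by simp
  consider (ee) p q where "s = 2 * p" "t = 2 * q" | (oe) p q where "s = 2 * p + 1" "t = 2 * q"
    | (oo) p q where "s = 2 * p + 1" "t = 2 * q + 1" | (eo) p q where "s = 2 * p" "t = 2 * q + 1"
    by (metis evenE oddE)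
  then show ?thesis
  proof cases
    case ee
    then have "S \<subseteq> T" using st by (auto simp: S_def T_def mas_vertex_even)
    then show ?thesis using edge sub ee unfolding S_def T_def by auto
  next
    case oe
    then have "S \<subseteq> T" using st k by (auto simp: S_def T_def mas_vertex_def reindex_def)
    then show ?thesis using edge sub oe unfolding S_def T_def by auto
  next
    case oo
    then have ST: "S = {p + 1}" "T = {reindex k n (q + 1)}" "p + 1 < reindex k n (q + 1)" "1 \<le> p"
      using st k by (auto simp: S_def T_def mas_vertex_def reindex_def)
    then have "\<not> is_singleton (S \<union> T)" "1 \<notin> S \<union> T" by (auto simp: is_singleton_def doubleton_eq_iff)
    then have "S \<union> T \<notin> mas_building_set n" using mas_iff[OF n sub(3)] by simp
    moreover have "S \<inter> T = {}" using ST by auto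
    ultimately show ?thesis using edge oo unfolding S_def T_def by auto
  next
    case eo
    define y where "y = reindex k n (q + 1)"
    have pq: "1 \<le> p" "p \<le> q" "q \<le> k" using st eo by auto
    have ST: "S = {1..p}" "T = {y}" using eo by (simp_all add: S_def T_def mas_vertex_def y_def)
    have y: "p < y" "y = n + 1 \<longleftrightarrow> q = k" "y = 2 \<longleftrightarrow> q = 1" using pq k by (auto simp: y_def reindex_def)
    have disj: "S \<inter> T = {}" using y by (auto simp: ST)
    have "1 \<in> S \<union> T" "y \<in> S \<union> T" "1 \<noteq> y" using pq y by (auto simp: ST)
    then have "\<not> is_singleton (S \<union> T)" unfolding is_singleton_def by (metis singletonD)
    moreover have "2 \<in> S \<union> T \<longleftrightarrow> 2 \<le> p \<or> q = 1" using y by (auto simp: ST)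
    moreover have "n + 1 \<in> S \<union> T \<longleftrightarrow> q = k" using y pq k by (auto simp: ST)
    \<comment> \<open>Since \<open>k\<close> is at least 2, \<open>q = k\<close> excludes
      \<open>q = 1\<close>; so 2 is missing while \<open>n + 1\<close> is present exactly for
      \<open>p = 1\<close> and \<open>q = k\<close>.\<close>
    ultimately have "S \<union> T \<in> mas_building_set n \<longleftrightarrow> \<not> (p = 1 \<and> q = k)"
      using mas_iff[OF n sub(3)] \<open>1 \<in> S \<union> T\<close> pq k by auto
    then show ?thesis using edge disj eo unfolding S_def T_def by auto
  qed
qed

lemma mas_configuration:
  assumes k: "2 \<le> k" "k \<le> n"
  shows "massey_configuration (N_mas n) set_encode (mas_vertex k n) k"
proof
  show "finite (\<Union>(N_mas n))" using k by (intro finite_N_mas_vertices) simp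
  show "{mas_vertex k n t} \<in> N_mas n" if "2 \<le> t" "t \<le> 2 * k + 1" for t
    using mas_vertex_in[OF k that] by (rule nested_complex_vertex)
qed (use k mas_vertex_less mas_vertex_edge nested_complex_down in blast)+

theorem theorem5p25:
  assumes coeff: "(\<forall>x::'k::{comm_ring_1,ring_char_0}. x \<noteq> 0 \<longrightarrow> x dvd 1) \<or> (\<int> :: 'k set) = UNIV"
  shows "\<exists>(\<alpha> :: nat \<Rightarrow> nat \<Rightarrow> nat \<Rightarrow> (nat set set \<times> nat set set \<Rightarrow> 'k) set)
          (N :: nat \<Rightarrow> nat \<Rightarrow> nat \<Rightarrow> int) (W :: nat \<Rightarrow> nat \<Rightarrow> nat \<Rightarrow> nat set \<Rightarrow> nat).
    (\<forall>n k. 2 \<le> n \<longrightarrow> 2 \<le> k \<longrightarrow> k \<le> n \<longrightarrow>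
       (\<forall>i\<in>{1..k}. \<alpha> n k i \<in> cohomology (R_mas n) (N n k i) (W n k i)) \<and>
       massey_strictly_defined (R_mas n) k (N n k) (W n k) (\<alpha> n k) \<and>
       massey_nontrivial (R_mas n) k (N n k) (W n k) (\<alpha> n k)) \<and>
    (\<exists>\<phi> :: nat \<Rightarrow> nat \<Rightarrow> nat \<Rightarrow> nat.
       (\<forall>r\<ge>2. \<forall>i\<in>{1..r+1}. \<phi> r r i = i) \<and>
       (\<forall>r s t. 2 \<le> r \<longrightarrow> r \<le> s \<longrightarrow> s \<le> t \<longrightarrow> (\<forall>i\<in>{1..r+1}. \<phi> s t (\<phi> r s i) = \<phi> r t i)) \<and>
       (\<forall>r s. 2 \<le> r \<longrightarrow> r \<le> s \<longrightarrow>
          inj_on (\<phi> r s) {1..r+1} \<and> \<phi> r s ` {1..r+1} \<subseteq> {1..s+1} \<and>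
          simplicial_embedding (image (\<phi> r s)) (N_mas r) (N_mas s) \<and>
          (\<forall>k. 2 \<le> k \<longrightarrow> k \<le> r \<longrightarrow>
             cohom_pullback set_encode set_encode (N_mas r) (image (\<phi> r s)) `
               massey_product (R_mas s) k (N s k) (W s k) (\<alpha> s k) =
             massey_product (R_mas r) k (N r k) (W r k) (\<alpha> r k))))"
proof -
  define \<alpha> :: "nat \<Rightarrow> nat \<Rightarrow> nat \<Rightarrow> (nat set set \<times> nat set set \<Rightarrow> 'k) set" where
    "\<alpha> n k i = cohom_class (R_mas n)
      (R_mono (N_mas n) {mas_vertex k n (2 * i + 1)} {mas_vertex k n (2 * i)})" for n k i
  define W :: "nat \<Rightarrow> nat \<Rightarrow> nat \<Rightarrow> nat set \<Rightarrow> nat" where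
    "W n k i = (\<lambda>x. if x \<in> {mas_vertex k n (2 * i), mas_vertex k n (2 * i + 1)} then 1 else 0)" for n k i
  \<comment> \<open>\<open>J\<close> and \<open>I\<close> are the index sets of the diagonal
    monomial, named for all \<open>n\<close> at once so that different complexes can be
    compared.\<close>
  define J where "J n k = mas_vertex k n ` {2 * 1..<2 * (k + 1)} -
    {mas_vertex k n 2, mas_vertex k n (2 * k + 1)}" for n k
  define I where "I n k = {mas_vertex k n 2, mas_vertex k n (2 * k + 1)}" for n k
  have product: "massey_product (R_mas n) k (\<lambda>_. 3) (W n k) (\<alpha> n k) =
      {cohom_class (R_mas n) (R_mono (N_mas n) (J n k) (I n k))}"
    and nontrivial: "cohom_class (R_mas n) (0 :: _ \<Rightarrow> 'k) \<noteq>
      cohom_class (R_mas n) (R_mono (N_mas n) (J n k) (I n k))"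
    and classes: "i \<in> {1..k} \<Longrightarrow> \<alpha> n k i \<in> cohomology (R_mas n) 3 (W n k i)"
    and basis: "(J n k, I n k) \<in> R_basis (N_mas n)"
    if k: "2 \<le> k" "k \<le> n" for n k i
  proof -
    interpret massey_configuration "N_mas n" set_encode "mas_vertex k n" k
      by (rule mas_configuration[OF k])
    show "massey_product (R_mas n) k (\<lambda>_. 3) (W n k) (\<alpha> n k) =
        {cohom_class (R_mas n) (R_mono (N_mas n) (J n k) (I n k))}"
      unfolding J_def I_def W_def[abs_def] \<alpha>_def[abs_def] by (rule massey_product_eq)
    show "cohom_class (R_mas n) (0 :: _ \<Rightarrow> 'k) \<noteq>
        cohom_class (R_mas n) (R_mono (N_mas n) (J n k) (I n k))"
      unfolding J_def I_def by (rule diagonal_nontrivial)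
    show "\<alpha> n k i \<in> cohomology (R_mas n) 3 (W n k i)" if "i \<in> {1..k}"
      unfolding \<alpha>_def W_def by (rule factor_in_cohomology[OF that])
    show "(J n k, I n k) \<in> R_basis (N_mas n)"
      unfolding J_def I_def by (rule R_basis_edge) (use edge[of 2 "2 * k + 1"] k in auto)
  qed
  \<comment> \<open>Both products are single classes represented by monomials, so naturality reduces
    to the embedding carrying \<open>J r k\<close> and \<open>I r k\<close> onto
    \<open>J s k\<close> and \<open>I s k\<close>.\<close>
  have "cohom_pullback set_encode set_encode (N_mas r) (image (reindex r s)) `
      massey_product (R_mas s) k (\<lambda>_. 3) (W s k) (\<alpha> s k) =
      massey_product (R_mas r) k (\<lambda>_. 3) (W r k) (\<alpha> r k)"
    if r: "2 \<le> r" "r \<le> s" and k: "2 \<le> k" "k \<le> r" for r s k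
  proof -
    interpret monotone_embedding set_encode set_encode "N_mas r" "N_mas s" "image (reindex r s)"
      by (rule reindex_monotone_embedding[OF r])
    have v: "reindex r s ` mas_vertex k r t = mas_vertex k s t" if "t \<le> 2 * k + 1" for t
      using reindex_mas_vertex[OF k(2) r(2) that] .
    have I: "image (reindex r s) ` I r k = I s k"
      using v[of 2] v[of "2 * k + 1"] k by (simp add: I_def)
    have "mas_vertex k r ` {2 * 1..<2 * (k + 1)} = J r k \<union> I r k"
      using k unfolding J_def I_def by auto
    then have sub: "mas_vertex k r ` {2 * 1..<2 * (k + 1)} \<subseteq> \<Union>(N_mas r)" "I r k \<subseteq> \<Union>(N_mas r)"
      using basis[OF k] by (auto simp: R_basis_def)
    have "image (reindex r s) ` J r k =
        image (reindex r s) ` mas_vertex k r ` {2 * 1..<2 * (k + 1)} - image (reindex r s) ` I r k"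
      unfolding J_def I_def[symmetric]
      by (rule inj_on_image_set_diff[OF inj]) (use sub in blast)+
    also have "image (reindex r s) ` mas_vertex k r ` {2 * 1..<2 * (k + 1)} =
        mas_vertex k s ` {2 * 1..<2 * (k + 1)}"
      unfolding image_image by (intro image_cong refl v) auto
    finally have J: "image (reindex r s) ` J r k = J s k" unfolding I by (simp add: J_def I_def)
    have "k \<le> s" using k r by simp
    have "cohom_pullback set_encode set_encode (N_mas r) (image (reindex r s))
        (cohom_class (R_mas s) (R_mono (N_mas s) (J s k) (I s k) :: _ \<Rightarrow> 'k)) =
        cohom_class (R_mas r) (R_mono (N_mas r) (J r k) (I r k))"
      unfolding pullback_class I[symmetric] J[symmetric] pullback_mono[OF basis[OF k]] ..
    then show ?thesis
      unfolding product[OF k] product[OF k(1) \<open>k \<le> s\<close>] by simp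
  qed
  moreover have "reindex s t (reindex r s i) = reindex r t i" if "r \<le> s" "s \<le> t" for r s t i
    using that by (simp add: reindex_def)
  moreover have "reindex r r i = i" if "i \<in> {1..r + 1}" for r i
    using that by (auto simp: reindex_def)
  moreover have "massey_strictly_defined (R_mas n) k (\<lambda>_. 3) (W n k) (\<alpha> n k)"
    "massey_nontrivial (R_mas n) k (\<lambda>_. 3) (W n k) (\<alpha> n k)" if "2 \<le> k" "k \<le> n" for n k
    unfolding massey_strictly_defined_def massey_nontrivial_def product[OF that]
    using nontrivial[OF that] by simp_all
  ultimately show ?thesis
    using classes reindex_inj reindex_range reindex_embedding
    by (intro exI[of _ \<alpha>] exI[of _ "\<lambda>_ _ _. 3"] exI[of _ W] exI[of _ reindex] conjI) simp_all
qed

end
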